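(* Let $1<p<\infty$ and let $T,T_0:\ell_p\to\ell_p$ be the bounded operators described in the context. Then $$\sigma(T_0,\ell_p)\subseteq\sigma(T,\ell_p),$$ and $\sigma(T,\ell_p)\setminus\sigma(T_0,\ell_p)$ contains a finite or countable number of eigenvalues of $T$ of finite type, with no accumulation point in $\sigma(T,\ell_p)\setminus\sigma(T_0,\ell_p)$.
   Context: $\ell_p$ is the complex Banach space of $p$-summable sequences $x=\{x_n\}_{n\ge1}$. Let $r_1,r_2\ge0$ and $s_1,s_2>0$ be real. Let $\{a_n\}_{n\ge1}\subset\mathbb{C}$ and $\{b_n\}_{n\ge1},\{c_n\}_{n\ge1}\subset\mathbb{C}\setminus\{0\}$ be sequences with $a_{2n-1}\to r_1$, $b_{2n-1}\to s_1$, $c_{2n-1}\to s_1$, $a_{2n}\to r_2$, $b_{2n}\to s_2$, $c_{2n}\to s_2$. The operator $T$ is $(Tx)_n=c_{n-2}x_{n-2}+a_nx_n+b_nx_{n+2}$ for $n\ge1$, where the term $c_{n-2}x_{n-2}$ is omitted for $n=1,2$. The operator $T_0$ is $(T_0x)_n=s_1x_{n-2}+r_1x_n+s_1x_{n+2}$ for $n$ odd and $(T_0x)_n=s_2x_{n-2}+r_2x_n+s_2x_{n+2}$ for $n$ even, with $x_{-1}=x_0=0$. $\sigma(A,X)$ is the spectrum. An eigenvalue $\lambda$ of $A\in B(X)$ is of finite type if it is an isolated point of the spectrum and the Riesz projection $\frac{1}{2\pi i}\int_\gamma(\mu I-A)^{-1}d\mu$ has finite rank, where $\gamma$ is a positively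 oriented small circle centred at $\lambda$ that separates $\lambda$ from the rest of the spectrum. *)

theory Defs
  imports "HOL-Complex_Analysis.Complex_Analysis"
begin

text \<open>
  Sequences are indexed by \<open>n \<ge> 1\<close>.  They are represented by functions on \<^typ>\<open>nat\<close>;
  index 0 is not part of the sequence, and elements of \<open>\<ell>\<^sub>p\<close> are required to vanish there.
  The exponent is an ordinary real number, so \<open>\<ell>\<^sub>p\<close> is a set, and operators on it are total
  functions of which only the values on this set matter.
\<close>

type_synonym seq = "nat \<Rightarrow> complex"

definition lp :: "real \<Rightarrow> seq set" where
  "lp p = {x. x 0 = 0 \<and> summable (\<lambda>n. norm (x n) powr p)}"

definition lp_norm :: "real \<Rightarrow> seq \<Rightarrow> real" where
  "lp_norm p x = (\<Sum>n. norm (x n) powr p) powr (1 / p)"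

definition bounded_op :: "real \<Rightarrow> (seq \<Rightarrow> seq) \<Rightarrow> bool" where
  "bounded_op p A \<longleftrightarrow>
     (\<forall>x\<in>lp p. A x \<in> lp p) \<and>
     (\<forall>x\<in>lp p. \<forall>y\<in>lp p. A (\<lambda>n. x n + y n) = (\<lambda>n. A x n + A y n)) \<and>
     (\<forall>z. \<forall>x\<in>lp p. A (\<lambda>n. z * x n) = (\<lambda>n. z * A x n)) \<and>
     (\<exists>K. \<forall>x\<in>lp p. lp_norm p (A x) \<le> K * lp_norm p x)"

definition shifted :: "complex \<Rightarrow> (seq \<Rightarrow> seq) \<Rightarrow> seq \<Rightarrow> seq" where
  "shifted \<mu> A x = (\<lambda>n. \<mu> * x n - A x n)"

definition spectrum :: "real \<Rightarrow> (seq \<Rightarrow> seq) \<Rightarrow> complex set" where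
  "spectrum p A =
     {\<mu>. \<not> (\<exists>B. bounded_op p B \<and>
              (\<forall>x\<in>lp p. B (shifted \<mu> A x) = x \<and> shifted \<mu> A (B x) = x))}"

text \<open>The inverse of \<open>\<mu>I - A\<close>, meaningful for \<open>\<mu>\<close> outside the spectrum.\<close>

definition resolvent :: "real \<Rightarrow> (seq \<Rightarrow> seq) \<Rightarrow> complex \<Rightarrow> seq \<Rightarrow> seq" where
  "resolvent p A \<mu> = inv_into (lp p) (shifted \<mu> A)"

text \<open>
  Integration of operator-valued functions, with convergence in the operator norm; the two
  definitions copy those of \<^const>\<open>has_integral\<close> (on an interval) and
  \<^const>\<open>has_contour_integral\<close>.
\<close>

definition op_has_integral ::
  "real \<Rightarrow> (real \<Rightarrow> seq \<Rightarrow> seq) \<Rightarrow> (seq \<Rightarrow> seq) \<Rightarrow> real \<Rightarrow> real \<Rightarrow> bool" where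
  "op_has_integral p F P a b \<longleftrightarrow>
     (\<forall>t\<in>{a..b}. bounded_op p (F t)) \<and> bounded_op p P \<and>
     (\<forall>e>0. \<exists>g. gauge g \<and>
        (\<forall>D. D tagged_division_of {a..b} \<and> g fine D \<longrightarrow>
           (\<forall>x\<in>lp p. lp_norm p (\<lambda>n. (\<Sum>(t,k)\<in>D. measure lborel k *\<^sub>R F t x n) - P x n)
                        \<le> e * lp_norm p x)))"

definition op_has_contour_integral ::
  "real \<Rightarrow> (complex \<Rightarrow> seq \<Rightarrow> seq) \<Rightarrow> (seq \<Rightarrow> seq) \<Rightarrow> (real \<Rightarrow> complex) \<Rightarrow> bool" where
  "op_has_contour_integral p F P \<gamma> \<longleftrightarrow>
     op_has_integral p
       (\<lambda>t x n. F (\<gamma> t) x n * vector_derivative \<gamma> (at t within {0..1})) P 0 1"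

definition is_riesz_projection ::
  "real \<Rightarrow> (seq \<Rightarrow> seq) \<Rightarrow> complex \<Rightarrow> real \<Rightarrow> (seq \<Rightarrow> seq) \<Rightarrow> bool" where
  "is_riesz_projection p A \<mu> r P \<longleftrightarrow>
     op_has_contour_integral p
       (\<lambda>z x n. 1 / (2 * of_real pi * \<i>) * resolvent p A z x n) P (circlepath \<mu> r)"

definition finite_rank :: "real \<Rightarrow> (seq \<Rightarrow> seq) \<Rightarrow> bool" where
  "finite_rank p P \<longleftrightarrow>
     (\<exists>S. finite S \<and> S \<subseteq> lp p \<and>
          (\<forall>x\<in>lp p. \<exists>u. P x = (\<lambda>n. \<Sum>s\<in>S. u s * s n)))"

definition eigenvalue :: "real \<Rightarrow> (seq \<Rightarrow> seq) \<Rightarrow> complex \<Rightarrow> bool" where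
  "eigenvalue p A \<mu> \<longleftrightarrow> (\<exists>x\<in>lp p. x \<noteq> (\<lambda>n. 0) \<and> A x = (\<lambda>n. \<mu> * x n))"

text \<open>
  By Cauchy's theorem the Riesz projection does not depend on the radius of the separating
  circle, so the radius may be quantified existentially.
\<close>

definition finite_type_eigenvalue :: "real \<Rightarrow> (seq \<Rightarrow> seq) \<Rightarrow> complex \<Rightarrow> bool" where
  "finite_type_eigenvalue p A \<mu> \<longleftrightarrow>
     eigenvalue p A \<mu> \<and> \<mu> isolated_in spectrum p A \<and>
     (\<exists>r>0. cball \<mu> r \<inter> spectrum p A = {\<mu>} \<and>
        (\<exists>P. is_riesz_projection p A \<mu> r P \<and> finite_rank p P))"

definition op_T :: "seq \<Rightarrow> seq \<Rightarrow> seq \<Rightarrow> seq \<Rightarrow> seq" where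
  "op_T a b c x =
     (\<lambda>n. if n = 0 then 0
          else (if n \<le> 2 then 0 else c (n - 2) * x (n - 2)) + a n * x n + b n * x (n + 2))"

definition op_T0 :: "real \<Rightarrow> real \<Rightarrow> real \<Rightarrow> real \<Rightarrow> seq \<Rightarrow> seq" where
  "op_T0 r1 s1 r2 s2 x =
     (\<lambda>n. if n = 0 then 0
          else let r = of_real (if odd n then r1 else r2);
                   s = of_real (if odd n then s1 else s2)
               in (if n \<le> 2 then 0 else s * x (n - 2)) + r * x n + s * x (n + 2))"

end

(*
  For z off the spectrum of T0, the difference T - T0 is a finite-rank operator up to a small error
  that does not affect invertibility of z - T0.  Hence, near such a point, z - T is invertible
  exactly where a holomorphic determinant d does not vanish, and d times the resolvent of T is
  holomorphic by Cramer's rule.  The complement of the spectrum of T0 is connected and reaches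
  infinity, where T has no spectrum, so d cannot vanish identically near any point: off the spectrum
  of T0 the resolvent of T is meromorphic.  At a pole z0 the operators
  Q j = 1/(2 pi i) * (contour integral of (z - z0)^j * (z - T)^-1) satisfy (T - z0) Q j = Q (j + 1)
  and vanish for large j, so the last nonzero one consists of eigenvectors.  The recurrence given by
  the nonvanishing b determines an element of the kernel of (T - z0)^m by its first 2 m entries, so
  the Riesz projection Q 0 has finite rank.

  The spectrum of T0 is the union of the intervals [r1 - 2 s1, r1 + 2 s1] and [r2 - 2 s2, r2 + 2 s2]:
  outside them z - T0 factors into shifts of norm less than 1, inside them truncated plane waves far
  out are approximate eigenvectors of T0, and of T as well.
*)
theory Submission
  imports Defs "Jordan_Normal_Form.Determinant"
begin

section \<open>Holomorphic families of matrices\<close>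

text \<open>Since the exponent is a variable, l_p is a set of functions and not a type. Analysis is
  therefore done one coordinate at a time: holomorphy, contour integrals and limits concern the
  scalar functions \<open>resolvent p A z x n\<close>, and norms return through one principle,
  namely that a norm bound valid along a sequence passes to its coordinatewise limit. This serves
  the Neumann series as well as the integrals.

  Two features of the operators fit this setting. Each row of T has finitely many entries, so T
  commutes with coordinatewise integrals. The finite-rank correction has finitely many nonzero
  columns, so removing it amounts to a linear system for the first entries of the unknown; d is the
  determinant of that system.

  Such a d exists only near a given point, because the approximation of T - T0 must be finer the
  larger the resolvent of T0 is. Different points use different matrices, even of different sizes.
  What is carried along the connected set is thus not one function d but the property that the
  spectrum of T fills a neighbourhood.\<close>

lemma holomorphic_det:
  assumes "\<And>i j. i < M \<Longrightarrow> j < M \<Longrightarrow> (\<lambda>z. E z i j) holomorphic_on S"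
  shows "(\<lambda>z. Determinant.det (mat M M (\<lambda>(i, j). E z i j))) holomorphic_on S"
proof -
  have "Determinant.det (mat M M (\<lambda>(i, j). E z i j))
      = (\<Sum>\<pi> | \<pi> permutes {0..<M}. signof \<pi> * (\<Prod>i = 0..<M. E z i (\<pi> i)))" for z
    by (subst det_def'[of _ M]) (auto intro!: sum.cong prod.cong simp: permutes_in_image)
  moreover have "(\<lambda>z. \<Sum>\<pi> | \<pi> permutes {0..<M}. signof \<pi> * (\<Prod>i = 0..<M. E z i (\<pi> i))) holomorphic_on S"
    by (intro holomorphic_intros assms) (auto simp: permutes_in_image)
  ultimately show ?thesis by simp
qed

text \<open>The adjugate replaces the inverse because its entries are minors up to sign, hence
  holomorphic even where the matrix is singular. The last clause provides a kernel vector at the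
  singular points.\<close>

lemma holomorphic_adjugate:
  fixes D :: "complex \<Rightarrow> nat \<Rightarrow> nat \<Rightarrow> complex"
  assumes D: "\<And>i j. i < M \<Longrightarrow> j < M \<Longrightarrow> (\<lambda>z. D z i j) holomorphic_on S"
  obtains d C where "d holomorphic_on S"
    and "\<And>i j. i < M \<Longrightarrow> j < M \<Longrightarrow> (\<lambda>z. C z i j) holomorphic_on S"
    and "\<And>z i k. i < M \<Longrightarrow> k < M \<Longrightarrow> (\<Sum>j<M. D z i j * C z j k) = (if i = k then d z else 0)"
    and "\<And>z i k. i < M \<Longrightarrow> k < M \<Longrightarrow> (\<Sum>j<M. C z i j * D z j k) = (if i = k then d z else 0)"
    and "\<And>z. d z = 0 \<Longrightarrow> \<exists>\<xi>. (\<exists>i<M. \<xi> i \<noteq> 0) \<and> (\<forall>i<M. (\<Sum>j<M. D z i j * \<xi> j) = 0)"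
proof -
  define A where "A z = mat M M (\<lambda>(i, j). D z i j)" for z
  define d where "d z = Determinant.det (A z)" for z
  define C where "C z i j = adj_mat (A z) $$ (i, j)" for z i j
  have A: "A z \<in> carrier_mat M M" for z by (simp add: A_def)
  note adj = adj_mat[OF A]
  show thesis
  proof (rule that[of d C])
    show "d holomorphic_on S"
      unfolding d_def A_def by (rule holomorphic_det[OF D])
    show "(\<lambda>z. C z i j) holomorphic_on S" if "i < M" "j < M" for i j
    proof -
      \<comment> \<open>Entry (i, j) of the adjugate is the cofactor at (j, i); the shifted indices
        skip row j and column i.\<close>
      have "C z i j = (-1) ^ (j + i) * Determinant.det (mat (M - 1) (M - 1)
          (\<lambda>(k, l). D z (if k < j then k else Suc k) (if l < i then l else Suc l)))" for z
        using that
        by (simp add: C_def adj_mat_def cofactor_def A_def mat_delete_def)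
          (intro arg_cong[of _ _ Determinant.det] cong_mat; auto)
      moreover have "(\<lambda>z. (-1) ^ (j + i) * Determinant.det (mat (M - 1) (M - 1)
          (\<lambda>(k, l). D z (if k < j then k else Suc k) (if l < i then l else Suc l)))) holomorphic_on S"
        by (intro holomorphic_intros holomorphic_det D) auto
      ultimately show ?thesis by simp
    qed
    show "(\<Sum>j<M. D z i j * C z j k) = (if i = k then d z else 0)" if "i < M" "k < M" for z i k
    proof -
      have "(A z * adj_mat (A z)) $$ (i, k) = (\<Sum>j<M. D z i j * C z j k)"
        using that A[of z] adj(1)[of z]
        by (simp add: scalar_prod_def C_def A_def lessThan_atLeast0)
      then show ?thesis using that by (cases "i = k") (auto simp: adj(2) d_def)
    qed
    show "(\<Sum>j<M. C z i j * D z j k) = (if i = k then d z else 0)" if "i < M" "k < M" for z i k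
    proof -
      have "(adj_mat (A z) * A z) $$ (i, k) = (\<Sum>j<M. C z i j * D z j k)"
        using that A[of z] adj(1)[of z]
        by (simp add: scalar_prod_def C_def A_def lessThan_atLeast0)
      then show ?thesis using that by (cases "i = k") (auto simp: adj(3) d_def)
    qed
    show "\<exists>\<xi>. (\<exists>i<M. \<xi> i \<noteq> 0) \<and> (\<forall>i<M. (\<Sum>j<M. D z i j * \<xi> j) = 0)" if "d z = 0" for z
    proof -
      from that det_0_iff_vec_prod_zero[OF A] obtain v where
        v: "v \<in> carrier_vec M" "v \<noteq> 0\<^sub>v M" "A z *\<^sub>v v = 0\<^sub>v M" by (auto simp: d_def)
      have "\<exists>i<M. vec_index v i \<noteq> 0" using v(1,2) by (metis carrier_vecD eq_vecI index_zero_vec)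
      moreover have "(\<Sum>j<M. D z i j * vec_index v j) = 0" if "i < M" for i
      proof -
        have "vec_index (A z *\<^sub>v v) i = (\<Sum>j<M. D z i j * vec_index v j)"
          using that v(1) by (simp add: scalar_prod_def A_def lessThan_atLeast0)
        then show ?thesis using v(3) that by simp
      qed
      ultimately show ?thesis by blast
    qed
  qed
qed

section \<open>The sequence space\<close>

text \<open>For positive u and v this is convexity of the power. If one of them vanishes, it reduces
  to \<open>s powr p \<le> s\<close> for s between 0 and 1.\<close>

lemma powr_convex_combination:
  fixes p t u v :: real
  assumes "1 \<le> p" "0 < t" "t < 1" "0 \<le> u" "0 \<le> v"
  shows "(t * u + (1 - t) * v) powr p \<le> t * u powr p + (1 - t) * v powr p"
proof -
  have small: "s powr p \<le> s" if "0 < s" "s < 1" for s :: real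
    using powr_mono'[of 1 p s] that assms(1) by simp
  consider "u = 0" | "v = 0" | "0 < u" "0 < v" using assms by linarith
  then show ?thesis
  proof cases
    case 1
    with assms small[of "1 - t"] show ?thesis by (simp add: powr_mult mult_right_mono)
  next
    case 2
    with assms small[of t] show ?thesis by (simp add: powr_mult mult_right_mono)
  next
    case 3
    with convex_onD[OF powr_convex[OF assms(1)], of "1 - t" u v] assms show ?thesis by simp
  qed
qed

locale lp_exponent =
  fixes p :: real
  assumes p_ge_1: "1 \<le> p"
begin

abbreviation nrm :: "seq \<Rightarrow> real" where "nrm \<equiv> lp_norm p"

lemma p_pos [simp]: "0 < p" "0 \<le> p" "p \<noteq> 0"
  using p_ge_1 by auto

lemma powr_p_cancel: "0 \<le> C \<Longrightarrow> (C powr p) powr (1 / p) = C" "0 \<le> C \<Longrightarrow> (C powr (1 / p)) powr p = C"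
  by (simp_all only: powr_powr nonzero_mult_div_cancel_left[OF p_pos(3)] times_divide_eq_right
        times_divide_eq_left mult_1_right mult_1_left divide_self[OF p_pos(3)] powr_one)

lemma nrm_nonneg [simp]: "0 \<le> nrm x"
  by (simp add: lp_norm_def)

lemma zero_in_lp [simp, intro]: "(\<lambda>n. 0) \<in> lp p"
  using p_ge_1 by (simp add: lp_def)

lemma nrm_zero [simp]: "nrm (\<lambda>n. 0) = 0"
  using p_ge_1 by (simp add: lp_norm_def)

lemma lp_0: "x \<in> lp p \<Longrightarrow> x 0 = 0"
  by (simp add: lp_def)

text \<open>Membership and the norm bound are reduced to partial sums, so that domination,
  Minkowski's inequality and limits become statements about finite sums.\<close>

lemma lpI_sum_le:
  assumes "x 0 = 0" "0 \<le> C" "\<And>M. (\<Sum>n<M. norm (x n) powr p) \<le> C powr p"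
  shows "x \<in> lp p" and "nrm x \<le> C"
proof -
  have s: "summable (\<lambda>n. norm (x n) powr p)"
    by (rule summableI_nonneg_bounded[where x = "C powr p"]) (use assms(3) in auto)
  then show "x \<in> lp p" using assms(1) by (simp add: lp_def)
  have "(\<Sum>n. norm (x n) powr p) \<le> C powr p"
    by (rule suminf_le_const[OF s assms(3)])
  then have "nrm x \<le> (C powr p) powr (1 / p)"
    unfolding lp_norm_def using p_ge_1 by (intro powr_mono2) (auto intro!: suminf_nonneg s)
  also have "\<dots> = C" by (rule powr_p_cancel(1)[OF assms(2)])
  finally show "nrm x \<le> C" .
qed

lemma sum_powr_le_nrm:
  assumes "x \<in> lp p" "finite A"
  shows "(\<Sum>n\<in>A. norm (x n) powr p) \<le> nrm x powr p"
proof -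
  have s: "summable (\<lambda>n. norm (x n) powr p)" using assms by (simp add: lp_def)
  have "nrm x powr p = (\<Sum>n. norm (x n) powr p)"
    unfolding lp_norm_def by (rule powr_p_cancel(2)[OF suminf_nonneg[OF s]]) simp
  with sum_le_suminf[OF s assms(2)] show ?thesis by simp
qed

lemma norm_le_nrm: "x \<in> lp p \<Longrightarrow> norm (x n) \<le> nrm x"
  using sum_powr_le_nrm[of x "{n}"] p_ge_1 powr_less_mono2[of p "nrm x" "norm (x n)"]
  by (force simp: not_le[symmetric])

lemma nrm_eq_0: "x \<in> lp p \<Longrightarrow> nrm x = 0 \<Longrightarrow> x = (\<lambda>n. 0)"
  using norm_le_nrm[of x] by (metis ext norm_le_zero_iff)

text \<open>The index map f lets one lemma cover multiplication and both shifts. Injectivity is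
  asked only on the support of y, since n - 2 on natural numbers sends 0, 1 and 2 to the same
  index.\<close>

lemma lp_dominated:
  assumes "x \<in> lp p" "0 \<le> C" "y 0 = 0" "inj_on f {n. y n \<noteq> 0}"
    and "\<And>n. y n \<noteq> 0 \<Longrightarrow> norm (y n) \<le> C * norm (x (f n))"
  shows "y \<in> lp p" and "nrm y \<le> C * nrm x"
proof -
  have "(\<Sum>n<M. norm (y n) powr p) \<le> (C * nrm x) powr p" for M
  proof -
    let ?A = "{n. y n \<noteq> 0} \<inter> {..<M}"
    have inj: "inj_on f ?A" using assms(4) by (rule inj_on_subset) auto
    have "(\<Sum>n<M. norm (y n) powr p) = (\<Sum>n\<in>?A. norm (y n) powr p)"
      using p_ge_1 by (intro sum.mono_neutral_right) auto
    also have "\<dots> \<le> (\<Sum>n\<in>?A. C powr p * norm (x (f n)) powr p)"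
    proof (rule sum_mono)
      fix n assume "n \<in> ?A"
      then have "norm (y n) powr p \<le> (C * norm (x (f n))) powr p"
        using assms(5) p_ge_1 by (intro powr_mono2) auto
      then show "norm (y n) powr p \<le> C powr p * norm (x (f n)) powr p"
        using assms(2) by (simp add: powr_mult)
    qed
    also have "\<dots> = C powr p * (\<Sum>n\<in>f ` ?A. norm (x n) powr p)"
      by (simp add: sum_distrib_left sum.reindex[OF inj])
    also have "\<dots> \<le> C powr p * nrm x powr p"
      by (intro mult_left_mono sum_powr_le_nrm assms) auto
    finally show ?thesis using assms(2) by (simp add: powr_mult)
  qed
  from lpI_sum_le[OF assms(3) _ this] assms(2) show "y \<in> lp p" "nrm y \<le> C * nrm x" by simp_all
qed

lemma lp_scale:
  assumes "x \<in> lp p"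
  shows "(\<lambda>n. z * x n) \<in> lp p" and "nrm (\<lambda>n. z * x n) \<le> norm z * nrm x"
proof -
  have "z * x 0 = 0" using lp_0[OF assms] by simp
  note * = lp_dominated[of x "norm z" "\<lambda>n. z * x n" id, OF assms norm_ge_zero this]
  show "(\<lambda>n. z * x n) \<in> lp p" "nrm (\<lambda>n. z * x n) \<le> norm z * nrm x"
    by (rule *; simp add: norm_mult)+
qed

lemma lp_add:
  assumes x: "x \<in> lp p" and y: "y \<in> lp p"
  shows "(\<lambda>n. x n + y n) \<in> lp p" and "nrm (\<lambda>n. x n + y n) \<le> nrm x + nrm y"
proof -
  have "(\<lambda>n. x n + y n) \<in> lp p \<and> nrm (\<lambda>n. x n + y n) \<le> nrm x + nrm y"
  proof (cases "nrm x = 0 \<or> nrm y = 0")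
    case True
    then show ?thesis using nrm_eq_0[OF x] nrm_eq_0[OF y] x y by auto
  next
    case False
    define a b where "a = nrm x" and "b = nrm y"
    \<comment> \<open>With this weight (x + y) / (a + b) is the convex combination t (x / a) + (1 -
      t) (y / b) of two sequences of norm 1.\<close>
    define t where "t = a / (a + b)"
    have ab: "0 < a" "0 < b" using False by (auto simp: a_def b_def less_le)
    have t: "0 < t" "t < 1" "1 - t = b / (a + b)" using ab by (auto simp: t_def field_simps)
    have pw: "norm (x n + y n) powr p \<le>
       (a + b) powr p * (t * (norm (x n) powr p / a powr p) + (1 - t) * (norm (y n) powr p / b powr p))"
      for n
    proof -
      have "(a + b) * (t * (norm (x n) / a)) = norm (x n)" "(a + b) * ((1 - t) * (norm (y n) / b)) = norm (y n)"
        unfolding t(3) using ab by (simp_all add: t_def)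
      then have "norm (x n) + norm (y n) = (a + b) * (t * (norm (x n) / a) + (1 - t) * (norm (y n) / b))"
        by (simp only: distrib_left)
      then have "norm (x n + y n) powr p
          \<le> ((a + b) * (t * (norm (x n) / a) + (1 - t) * (norm (y n) / b))) powr p"
        using norm_triangle_ineq[of "x n" "y n"] p_ge_1 by (intro powr_mono2) auto
      also have "\<dots> = (a + b) powr p * (t * (norm (x n) / a) + (1 - t) * (norm (y n) / b)) powr p"
        using ab t by (simp add: powr_mult)
      also have "\<dots> \<le> (a + b) powr p *
          (t * (norm (x n) / a) powr p + (1 - t) * (norm (y n) / b) powr p)"
        using ab t by (intro mult_left_mono powr_convex_combination p_ge_1) auto
      finally show ?thesis using ab by (simp add: powr_divide)
    qed
    have "(\<Sum>n<M. norm (x n + y n) powr p) \<le> (a + b) powr p" for M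
    proof -
      have "(\<Sum>n<M. norm (x n + y n) powr p) \<le> (\<Sum>n<M. (a + b) powr p *
          (t * (norm (x n) powr p / a powr p) + (1 - t) * (norm (y n) powr p / b powr p)))"
        by (intro sum_mono pw)
      also have "\<dots> = (a + b) powr p * (t * ((\<Sum>n<M. norm (x n) powr p) / a powr p)
           + (1 - t) * ((\<Sum>n<M. norm (y n) powr p) / b powr p))"
        by (simp add: sum_distrib_left sum.distrib sum_divide_distrib distrib_left mult_ac)
      also have "\<dots> \<le> (a + b) powr p * (t * 1 + (1 - t) * 1)"
        using ab t sum_powr_le_nrm[OF x, of "{..<M}"] sum_powr_le_nrm[OF y, of "{..<M}"]
        by (intro mult_left_mono add_mono) (auto simp: a_def b_def)
      finally show ?thesis by simp
    qed
    from lpI_sum_le[OF _ _ this] ab x y show ?thesis by (simp add: a_def b_def lp_0)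
  qed
  then show "(\<lambda>n. x n + y n) \<in> lp p" "nrm (\<lambda>n. x n + y n) \<le> nrm x + nrm y" by auto
qed

lemma lp_diff:
  assumes x: "x \<in> lp p" and y: "y \<in> lp p"
  shows "(\<lambda>n. x n - y n) \<in> lp p" and "nrm (\<lambda>n. x n - y n) \<le> nrm x + nrm y"
  using lp_add[OF x lp_scale(1)[OF y, of "-1"]] lp_scale(2)[OF y, of "-1"] by auto

lemma lp_sum:
  assumes "finite A" "\<And>i. i \<in> A \<Longrightarrow> f i \<in> lp p"
  shows "(\<lambda>n. \<Sum>i\<in>A. f i n) \<in> lp p" and "nrm (\<lambda>n. \<Sum>i\<in>A. f i n) \<le> (\<Sum>i\<in>A. nrm (f i))"
proof -
  have "(\<lambda>n. \<Sum>i\<in>A. f i n) \<in> lp p \<and> nrm (\<lambda>n. \<Sum>i\<in>A. f i n) \<le> (\<Sum>i\<in>A. nrm (f i))"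
    using assms
  proof (induction A rule: finite_induct)
    case empty
    then show ?case by simp
  next
    case (insert i A)
    then show ?case using lp_add[of "f i" "\<lambda>n. \<Sum>i\<in>A. f i n"] by auto
  qed
  then show "(\<lambda>n. \<Sum>i\<in>A. f i n) \<in> lp p" "nrm (\<lambda>n. \<Sum>i\<in>A. f i n) \<le> (\<Sum>i\<in>A. nrm (f i))" by auto
qed

text \<open>Fatou's lemma for l_p: the bound holds for each finite partial sum, where coordinatewise
  convergence is enough. It plays the part of completeness in what follows.\<close>

lemma lp_pointwise_limit:
  assumes "\<And>k. f k \<in> lp p" "\<And>k. nrm (f k) \<le> C" "\<And>n. (\<lambda>k. f k n) \<longlonglongrightarrow> x n"
  shows "x \<in> lp p" and "nrm x \<le> C"
proof -
  have C: "0 \<le> C" using order_trans[OF nrm_nonneg assms(2)] .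
  have "(\<lambda>k. f k 0) \<longlonglongrightarrow> 0" using assms(1) by (simp add: lp_0)
  with assms(3)[of 0] have 0: "x 0 = 0" using LIMSEQ_unique by blast
  have "(\<Sum>n<M. norm (x n) powr p) \<le> C powr p" for M
  proof (rule LIMSEQ_le_const2)
    show "(\<lambda>k. \<Sum>n<M. norm (f k n) powr p) \<longlonglongrightarrow> (\<Sum>n<M. norm (x n) powr p)"
      using p_ge_1 by (intro tendsto_sum tendsto_powr2 tendsto_norm assms tendsto_const) auto
    show "\<exists>N. \<forall>k\<ge>N. (\<Sum>n<M. norm (f k n) powr p) \<le> C powr p"
    proof (intro exI allI impI)
      fix k
      have "(\<Sum>n<M. norm (f k n) powr p) \<le> nrm (f k) powr p"
        by (rule sum_powr_le_nrm[OF assms(1)]) simp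
      also have "\<dots> \<le> C powr p" using assms(2) p_ge_1 by (intro powr_mono2) auto
      finally show "(\<Sum>n<M. norm (f k n) powr p) \<le> C powr p" .
    qed
  qed
  from lpI_sum_le[OF 0 C this] show "x \<in> lp p" "nrm x \<le> C" by auto
qed

lemma lp_finite_support:
  assumes "finite S" "0 \<notin> S" "\<And>n. n \<notin> S \<Longrightarrow> x n = 0"
  shows "x \<in> lp p"
  unfolding lp_def using assms p_ge_1 by (auto intro!: summable_finite[of S])

definition unit_seq :: "nat \<Rightarrow> seq" where
  "unit_seq j = (\<lambda>n. if n = j then 1 else 0)"

lemma nrm_finite_support:
  assumes "finite S" "0 \<notin> S" "\<And>n. n \<notin> S \<Longrightarrow> x n = 0"
  shows "nrm x \<le> (\<Sum>n\<in>S. norm (x n))"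
proof -
  define u where "u k = (\<lambda>n. if n = k then x k else 0)" for k
  have u: "u k \<in> lp p" "nrm (u k) \<le> norm (x k)" if "k \<in> S" for k
  proof -
    show "u k \<in> lp p" by (rule lp_finite_support[of S]) (use assms that in \<open>auto simp: u_def\<close>)
    have "(\<Sum>n<M. norm (u k n) powr p) \<le> norm (x k) powr p" for M
    proof -
      have "(\<Sum>n<M. norm (u k n) powr p) = (\<Sum>n<M. if n = k then norm (x k) powr p else 0)"
        using p_ge_1 by (intro sum.cong) (auto simp: u_def)
      then show ?thesis by simp
    qed
    then show "nrm (u k) \<le> norm (x k)" 
      using lpI_sum_le(2)[of "u k" "norm (x k)"] that assms by (auto simp: u_def)
  qed
  have "x = (\<lambda>n. \<Sum>k\<in>S. u k n)"
    using assms by (auto simp: u_def fun_eq_iff)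
  then have "nrm x \<le> (\<Sum>k\<in>S. nrm (u k))" using lp_sum(2)[OF assms(1) u(1)] by auto
  also have "\<dots> \<le> (\<Sum>n\<in>S. norm (x n))" by (intro sum_mono u)
  finally show ?thesis .
qed

section \<open>Bounded operators and resolvents\<close>

abbreviation bop :: "(seq \<Rightarrow> seq) \<Rightarrow> bool" where "bop \<equiv> bounded_op p"

lemma bop_in_lp: "bop A \<Longrightarrow> x \<in> lp p \<Longrightarrow> A x \<in> lp p"
  and bop_add: "bop A \<Longrightarrow> x \<in> lp p \<Longrightarrow> y \<in> lp p \<Longrightarrow> A (\<lambda>n. x n + y n) = (\<lambda>n. A x n + A y n)"
  and bop_scale: "bop A \<Longrightarrow> x \<in> lp p \<Longrightarrow> A (\<lambda>n. z * x n) = (\<lambda>n. z * A x n)"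
  by (auto simp: bounded_op_def)

lemma bop_diff:
  "bop A \<Longrightarrow> x \<in> lp p \<Longrightarrow> y \<in> lp p \<Longrightarrow> A (\<lambda>n. x n - y n) = (\<lambda>n. A x n - A y n)"
  using bop_add[of A x "\<lambda>n. -1 * y n"] bop_scale[of A y "-1"] lp_scale(1)[of y "-1"] by simp

lemma bop_zero: "bop A \<Longrightarrow> A (\<lambda>n. 0) = (\<lambda>n. 0)"
  using bop_scale[of A "\<lambda>n. 0" 0] by simp

lemma bop_sum:
  assumes "bop A" "finite S" "\<And>i. i \<in> S \<Longrightarrow> f i \<in> lp p"
  shows "A (\<lambda>n. \<Sum>i\<in>S. f i n) = (\<lambda>n. \<Sum>i\<in>S. A (f i) n)"
  using assms(2,3)
proof (induction S rule: finite_induct)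
  case empty
  then show ?case by (simp add: bop_zero assms)
next
  case (insert i S)
  then show ?case using bop_add[OF assms(1), of "f i" "\<lambda>n. \<Sum>i\<in>S. f i n"] lp_sum(1)[of S f] by auto
qed

lemma bop_bound:
  assumes "bop A"
  obtains K where "0 \<le> K" "\<And>x. x \<in> lp p \<Longrightarrow> nrm (A x) \<le> K * nrm x"
proof -
  from assms obtain K where K: "\<forall>x\<in>lp p. nrm (A x) \<le> K * nrm x"
    by (auto simp: bounded_op_def)
  show thesis
  proof (rule that[of "max K 0"])
    fix x assume "x \<in> lp p"
    with K have "nrm (A x) \<le> K * nrm x" by auto
    also have "\<dots> \<le> max K 0 * nrm x" by (intro mult_right_mono) auto
    finally show "nrm (A x) \<le> max K 0 * nrm x" .
  qed simp
qed

lemma bopI: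
  assumes "\<And>x. x \<in> lp p \<Longrightarrow> A x \<in> lp p"
    and "\<And>x y. x \<in> lp p \<Longrightarrow> y \<in> lp p \<Longrightarrow> A (\<lambda>n. x n + y n) = (\<lambda>n. A x n + A y n)"
    and "\<And>z x. x \<in> lp p \<Longrightarrow> A (\<lambda>n. z * x n) = (\<lambda>n. z * A x n)"
    and "\<And>x. x \<in> lp p \<Longrightarrow> nrm (A x) \<le> K * nrm x"
  shows "bop A"
  using assms unfolding bounded_op_def by blast

text \<open>Operators are total functions that matter only on \<open>lp p\<close>. The lemma
  transfers boundedness to \<open>resolvent\<close>, whose values elsewhere are whatever
  \<open>inv_into\<close> returns.\<close>

lemma bop_cong:
  assumes "bop A" "\<And>x. x \<in> lp p \<Longrightarrow> B x = A x"
  shows "bop B"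
proof -
  from bop_bound[OF assms(1)] obtain K where "\<And>x. x \<in> lp p \<Longrightarrow> nrm (A x) \<le> K * nrm x" by blast
  with assms show ?thesis
    by (intro bopI[of B K]) (simp_all add: bop_in_lp bop_add bop_scale lp_add(1) lp_scale(1))
qed

lemma bop_comp:
  assumes "bop A" "bop B"
  shows "bop (\<lambda>x. A (B x))"
proof -
  obtain K where K: "0 \<le> K" "\<And>x. x \<in> lp p \<Longrightarrow> nrm (A x) \<le> K * nrm x" using bop_bound[OF assms(1)] by blast
  obtain L where L: "0 \<le> L" "\<And>x. x \<in> lp p \<Longrightarrow> nrm (B x) \<le> L * nrm x" using bop_bound[OF assms(2)] by blast
  have "nrm (A (B x)) \<le> (K * L) * nrm x" if "x \<in> lp p" for x
    using K(2)[OF bop_in_lp[OF assms(2) that]] mult_left_mono[OF L(2)[OF that] K(1)] by simp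
  then show ?thesis using assms
    by (intro bopI[of _ "K * L"]) (simp_all add: bop_in_lp bop_add bop_scale)
qed

lemma bop_lincomb:
  assumes "bop A" "bop B"
  shows "bop (\<lambda>x n. u * A x n + v * B x n)"
proof -
  obtain K where K: "0 \<le> K" "\<And>x. x \<in> lp p \<Longrightarrow> nrm (A x) \<le> K * nrm x" using bop_bound[OF assms(1)] by blast
  obtain L where L: "0 \<le> L" "\<And>x. x \<in> lp p \<Longrightarrow> nrm (B x) \<le> L * nrm x" using bop_bound[OF assms(2)] by blast
  show ?thesis
  proof (rule bopI)
    fix x assume x: "x \<in> lp p"
    note Ax = bop_in_lp[OF assms(1) x] and Bx = bop_in_lp[OF assms(2) x]
    show "(\<lambda>n. u * A x n + v * B x n) \<in> lp p" by (intro lp_add lp_scale Ax Bx)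
    have "nrm (\<lambda>n. u * A x n + v * B x n) \<le> norm u * nrm (A x) + norm v * nrm (B x)"
      using lp_add(2)[OF lp_scale(1)[OF Ax, of u] lp_scale(1)[OF Bx, of v]]
        lp_scale(2)[OF Ax, of u] lp_scale(2)[OF Bx, of v] by linarith
    also have "\<dots> \<le> norm u * (K * nrm x) + norm v * (L * nrm x)"
      using K L x by (intro add_mono mult_left_mono) auto
    finally show "nrm (\<lambda>n. u * A x n + v * B x n) \<le> (norm u * K + norm v * L) * nrm x"
      by (simp add: algebra_simps)
  qed (auto simp: bop_add[OF assms(1)] bop_add[OF assms(2)] bop_scale[OF assms(1)] bop_scale[OF assms(2)]
      algebra_simps)
qed

lemma bop_id: "bop (\<lambda>x. x)"
  by (rule bopI[of _ 1]) auto

lemma bop_scalar: "bop (\<lambda>x n. u * x n)"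
  using bop_lincomb[OF bop_id bop_id, of u 0] by simp

lemma bop_scaled: "bop A \<Longrightarrow> bop (\<lambda>x n. u * A x n)"
  using bop_lincomb[of A A u 0] by simp

lemma bop_minus: "bop A \<Longrightarrow> bop B \<Longrightarrow> bop (\<lambda>x n. A x n - B x n)"
  using bop_lincomb[of A B 1 "-1"] by simp

lemma bop_plus: "bop A \<Longrightarrow> bop B \<Longrightarrow> bop (\<lambda>x n. A x n + B x n)"
  using bop_lincomb[of A B 1 1] by simp

lemma bop_shifted: "bop A \<Longrightarrow> bop (shifted z A)"
  unfolding shifted_def using bop_minus[OF bop_scalar] by simp

section \<open>Bounded inverses and the Neumann series\<close>

definition inverse_pair :: "(seq \<Rightarrow> seq) \<Rightarrow> (seq \<Rightarrow> seq) \<Rightarrow> bool" where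
  "inverse_pair A B \<longleftrightarrow> bop B \<and> (\<forall>x\<in>lp p. B (A x) = x \<and> A (B x) = x)"

lemma spectrum_iff: "z \<notin> spectrum p A \<longleftrightarrow> (\<exists>B. inverse_pair (shifted z A) B)"
  by (auto simp: spectrum_def inverse_pair_def)

lemma inverse_pairD:
  assumes "inverse_pair A B"
  shows "bop B" and "x \<in> lp p \<Longrightarrow> B (A x) = x" and "x \<in> lp p \<Longrightarrow> A (B x) = x"
    and "x \<in> lp p \<Longrightarrow> B x \<in> lp p"
  using assms bop_in_lp by (auto simp: inverse_pair_def)

lemma inverse_pair_comp:
  assumes "bop A1" "bop A2" "inverse_pair A1 B1" "inverse_pair A2 B2"
    and "\<And>x. x \<in> lp p \<Longrightarrow> C x = A1 (A2 x)"
  shows "inverse_pair C (\<lambda>x. B2 (B1 x))"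
  unfolding inverse_pair_def
  using bop_comp[OF inverse_pairD(1)[OF assms(4)] inverse_pairD(1)[OF assms(3)]]
    inverse_pairD[OF assms(3)] inverse_pairD[OF assms(4)] bop_in_lp[OF assms(2)] assms(5) by simp

text \<open>The series is summed in each coordinate, and its sum lies in l_p by the limit principle
  \<open>lp_pointwise_limit\<close>. The point that needs care is A (B y), because a bounded
  operator need not respect coordinatewise convergence.\<close>

lemma neumann_series:
  assumes A: "bop A" and q: "0 \<le> q" "q < 1" "\<And>x. x \<in> lp p \<Longrightarrow> nrm (A x) \<le> q * nrm x"
  obtains B where "inverse_pair (\<lambda>x n. x n - A x n) B"
    "\<And>x. x \<in> lp p \<Longrightarrow> nrm (B x) \<le> nrm x / (1 - q)"
proof -
  define t where "t y k = (A ^^ k) y" for y k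
  have t_lp: "t y k \<in> lp p" if "y \<in> lp p" for y k
    using that by (induction k) (auto simp: t_def bop_in_lp[OF A])
  have t_nrm: "nrm (t y k) \<le> q ^ k * nrm y" if "y \<in> lp p" for y k
  proof (induction k)
    case 0
    then show ?case by (simp add: t_def)
  next
    case (Suc k)
    have "nrm (t y (Suc k)) \<le> q * nrm (t y k)" using q(3)[OF t_lp[OF that, of k]] by (simp add: t_def)
    also have "\<dots> \<le> q * (q ^ k * nrm y)" using q Suc by (intro mult_left_mono) auto
    finally show ?case by simp
  qed
  have t_shift: "t (t y m) k = t y (k + m)" for y k m by (simp add: t_def funpow_add)
  have t_add: "t (\<lambda>n. x n + y n) k = (\<lambda>n. t x k n + t y k n)" if "x \<in> lp p" "y \<in> lp p" for x y k
  proof (induction k)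
    case (Suc k)
    then show ?case using bop_add[OF A t_lp[OF that(1)] t_lp[OF that(2)], of k k] by (simp add: t_def)
  qed (simp add: t_def)
  have t_scale: "t (\<lambda>n. z * x n) k = (\<lambda>n. z * t x k n)" if "x \<in> lp p" for x z k
  proof (induction k)
    case (Suc k)
    then show ?case using bop_scale[OF A t_lp[OF that], of z k] by (simp add: t_def)
  qed (simp add: t_def)
  have t_sum: "summable (\<lambda>k. t y k n)" if "y \<in> lp p" for y n
  proof (rule summable_comparison_test')
    show "summable (\<lambda>k. q ^ k * nrm y)" using q by (intro summable_mult2 summable_geometric) auto
    show "norm (t y k n) \<le> q ^ k * nrm y" if "k \<ge> 0" for k
      using norm_le_nrm[OF t_lp, of y k n] t_nrm[of y k] \<open>y \<in> lp p\<close> by auto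
  qed
  define s where "s y m = (\<lambda>n. \<Sum>k<m. t y k n)" for y m
  define B where "B y = (\<lambda>n. \<Sum>k. t y k n)" for y
  have s_lim: "(\<lambda>m. s y m n) \<longlonglongrightarrow> B y n" if "y \<in> lp p" for y n
    using t_sum[OF that] by (simp add: s_def B_def summable_LIMSEQ)
  have s_lp: "s y m \<in> lp p" if "y \<in> lp p" for y m
    unfolding s_def by (intro lp_sum t_lp that) auto
  have s_nrm: "nrm (s y m) \<le> nrm y / (1 - q)" if "y \<in> lp p" for y m
  proof -
    have "nrm (s y m) \<le> (\<Sum>k<m. nrm (t y k))"
      unfolding s_def by (intro lp_sum t_lp that) auto
    also have "\<dots> \<le> (\<Sum>k<m. q ^ k * nrm y)" by (intro sum_mono t_nrm that)
    also have "\<dots> = (\<Sum>k<m. q ^ k) * nrm y" by (simp add: sum_distrib_right)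
    also have "\<dots> \<le> (\<Sum>k. q ^ k) * nrm y"
      using q by (intro mult_right_mono sum_le_suminf summable_geometric) auto
    also have "\<dots> = nrm y / (1 - q)" using q by (simp add: suminf_geometric)
    finally show ?thesis .
  qed
  have B_lp: "B y \<in> lp p" "nrm (B y) \<le> nrm y / (1 - q)" if "y \<in> lp p" for y
    using lp_pointwise_limit[OF s_lp[OF that] s_nrm[OF that] s_lim[OF that]] .
  \<comment> \<open>The remainder after m terms is B applied to the m-th iterate of A at y, so it
    has a norm bound of order \<open>q ^ m\<close>.\<close>
  have B_tail: "(\<lambda>n. B y n - s y m n) = B (t y m)" if "y \<in> lp p" for y m
    using suminf_minus_initial_segment[OF t_sum[OF that], of m] by (simp add: B_def s_def t_shift)
  have AB: "A (B y) n = B y n - y n" if y: "y \<in> lp p" for y n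
  proof (rule LIMSEQ_unique)
    have As: "A (s y m) = (\<lambda>n. s y (Suc m) n - y n)" for m
      unfolding s_def using bop_sum[OF A, of "{..<m}" "t y"] t_lp[OF y]
      by (simp add: sum.lessThan_Suc_shift t_def del: sum.lessThan_Suc)
    then show "(\<lambda>m. A (s y m) n) \<longlonglongrightarrow> B y n - y n"
      using LIMSEQ_Suc[OF s_lim[OF y, of n]] by (auto intro!: tendsto_intros)
    \<comment> \<open>The norm bound on the remainder survives the application of A and only then is
      read off at the coordinate n.\<close>
    have bd: "norm (A (s y m) n - A (B y) n) \<le> q ^ m * (q * nrm y / (1 - q))" for m
    proof -
      have "norm (A (s y m) n - A (B y) n) = norm (A (B (t y m)) n)"
        using bop_diff[OF A B_lp(1)[OF y] s_lp[OF y, of m]] B_tail[OF y, of m]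
        by (simp add: norm_minus_commute)
      also have "\<dots> \<le> nrm (A (B (t y m)))"
        by (intro norm_le_nrm bop_in_lp[OF A] B_lp t_lp y)
      also have "\<dots> \<le> q * nrm (B (t y m))" by (intro q B_lp t_lp y)
      also have "\<dots> \<le> q * (nrm (t y m) / (1 - q))" using q by (intro mult_left_mono B_lp t_lp y)
      also have "\<dots> \<le> q * (q ^ m * nrm y / (1 - q))"
        using q by (intro mult_left_mono divide_right_mono t_nrm y) auto
      finally show ?thesis by (simp add: field_simps)
    qed
    have "(\<lambda>m. q ^ m * (q * nrm y / (1 - q))) \<longlonglongrightarrow> 0"
      using q by (intro tendsto_mult_left_zero LIMSEQ_power_zero) auto
    then have "(\<lambda>m. A (s y m) n - A (B y) n) \<longlonglongrightarrow> 0"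
      by (rule Lim_null_comparison[rotated]) (use bd in auto)
    then show "(\<lambda>m. A (s y m) n) \<longlonglongrightarrow> A (B y) n" by (simp add: LIM_zero_iff)
  qed
  \<comment> \<open>The tail formula after one term says B y - y = B (A y).\<close>
  have BA: "B (A y) n = B y n - y n" if y: "y \<in> lp p" for y n
    using fun_cong[OF B_tail[OF y, of 1], of n] by (simp add: s_def t_def)
  have B_bop: "bop B"
  proof (rule bopI[of _ "1 / (1 - q)"])
    show "B (\<lambda>n. x n + y n) = (\<lambda>n. B x n + B y n)" if "x \<in> lp p" "y \<in> lp p" for x y
      using that by (simp add: B_def t_add suminf_add[OF t_sum t_sum])
    show "B (\<lambda>n. z * x n) = (\<lambda>n. z * B x n)" if "x \<in> lp p" for x z
      using that by (simp add: B_def t_scale suminf_mult[OF t_sum])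
  qed (use B_lp in auto)
  have "inverse_pair (\<lambda>x n. x n - A x n) B"
    unfolding inverse_pair_def using B_bop by (simp add: bop_diff bop_in_lp[OF A] AB BA)
  with B_lp(2) show thesis using that by blast
qed

text \<open>C - E = C (I - B E), and B E has norm at most 1/2. The fixed threshold 1/2 turns the
  Neumann bound into the factor 2.\<close>

lemma inverse_pair_perturb:
  assumes C: "bop C" "inverse_pair C B" and E: "bop E"
    and M: "0 \<le> M" "\<And>x. x \<in> lp p \<Longrightarrow> nrm (B x) \<le> M * nrm x"
    and e: "\<And>x. x \<in> lp p \<Longrightarrow> nrm (E x) \<le> e * nrm x" "M * e \<le> 1 / 2"
    and D: "\<And>x. x \<in> lp p \<Longrightarrow> D x = (\<lambda>n. C x n - E x n)"
  obtains B' where "inverse_pair D B'" "\<And>x. x \<in> lp p \<Longrightarrow> nrm (B' x) \<le> 2 * M * nrm x"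
proof -
  note B = inverse_pairD[OF C(2)]
  have BE: "bop (\<lambda>x. B (E x))" by (rule bop_comp[OF B(1) E])
  have "nrm (B (E x)) \<le> 1 / 2 * nrm x" if "x \<in> lp p" for x
  proof -
    have "nrm (B (E x)) \<le> M * nrm (E x)" by (intro M bop_in_lp[OF E] that)
    also have "\<dots> \<le> M * (e * nrm x)" by (intro mult_left_mono e M that)
    also have "\<dots> \<le> 1 / 2 * nrm x" using mult_right_mono[OF e(2), of "nrm x"] by simp
    finally show ?thesis .
  qed
  from neumann_series[OF BE _ _ this] obtain N where
    N: "inverse_pair (\<lambda>x n. x n - B (E x) n) N" "\<And>x. x \<in> lp p \<Longrightarrow> nrm (N x) \<le> nrm x / (1 - 1/2)"
    by auto
  have "inverse_pair D (\<lambda>x. N (B x))"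
  proof (rule inverse_pair_comp[OF C(1) _ C(2) N(1)])
    show "bop (\<lambda>x n. x n - B (E x) n)" by (rule bop_minus[OF bop_id BE])
    show "D x = C (\<lambda>n. x n - B (E x) n)" if "x \<in> lp p" for x
      using that by (simp add: D bop_diff[OF C(1)] bop_in_lp[OF BE] B(3) bop_in_lp[OF E])
  qed
  moreover have "nrm (N (B x)) \<le> 2 * M * nrm x" if "x \<in> lp p" for x
    using N(2)[OF B(4)[OF that]] M(2)[OF that] by simp
  ultimately show thesis using that by blast
qed

section \<open>The resolvent: perturbation, local bounds and holomorphy\<close>

lemma resolvent_eq:
  assumes "inverse_pair (shifted z A) B" "x \<in> lp p"
  shows "resolvent p A z x = B x"
proof -
  note B = inverse_pairD[OF assms(1)]
  have "inj_on (shifted z A) (lp p)" by (rule inj_on_inverseI[of _ B]) (simp add: B)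
  then have "inv_into (lp p) (shifted z A) (shifted z A (B x)) = B x"
    using B(4)[OF assms(2)] by (rule inv_into_f_f)
  then show ?thesis using B(3)[OF assms(2)] by (simp add: resolvent_def)
qed

lemma resolvent_inverse_pair:
  assumes "z \<notin> spectrum p A"
  shows "inverse_pair (shifted z A) (resolvent p A z)"
proof -
  from assms obtain B where B: "inverse_pair (shifted z A) B" by (auto simp: spectrum_iff)
  note eq = resolvent_eq[OF B]
  show ?thesis unfolding inverse_pair_def
  proof (intro conjI ballI)
    show "bop (resolvent p A z)" by (rule bop_cong[OF inverse_pairD(1)[OF B] eq])
    fix x assume x: "x \<in> lp p"
    show "shifted z A (resolvent p A z x) = x" using inverse_pairD[OF B] x by (simp add: eq)
    have "inj_on (shifted z A) (lp p)" by (rule inj_on_inverseI[of _ B]) (simp add: inverse_pairD[OF B])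
    then show "resolvent p A z (shifted z A x) = x" using x by (simp add: resolvent_def inv_into_f_f)
  qed
qed

lemmas resolvent_bop = inverse_pairD(1)[OF resolvent_inverse_pair]
  and resolvent_shifted = inverse_pairD(2)[OF resolvent_inverse_pair]
  and shifted_resolvent = inverse_pairD(3)[OF resolvent_inverse_pair]
  and resolvent_in_lp = inverse_pairD(4)[OF resolvent_inverse_pair]

text \<open>Operator and spectral parameter move together, and d and M depend on A0 and z0 alone.
  Thus the radius of a disc can be fixed before an approximating operator A is chosen.\<close>

lemma resolvent_perturb:
  assumes A0: "bop A0" and z0: "z0 \<notin> spectrum p A0"
  obtains d M where "0 < d" "0 \<le> M"
    "\<And>A z. bop A \<Longrightarrow> (\<And>x. x \<in> lp p \<Longrightarrow> nrm (\<lambda>n. A x n - A0 x n) \<le> d * nrm x) \<Longrightarrow> dist z z0 < d \<Longrightarrow>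
       z \<notin> spectrum p A"
    "\<And>A z x. bop A \<Longrightarrow> (\<And>x. x \<in> lp p \<Longrightarrow> nrm (\<lambda>n. A x n - A0 x n) \<le> d * nrm x) \<Longrightarrow> dist z z0 < d \<Longrightarrow>
       x \<in> lp p \<Longrightarrow> nrm (resolvent p A z x) \<le> M * nrm x"
proof -
  obtain K where K: "0 \<le> K" "\<And>x. x \<in> lp p \<Longrightarrow> nrm (resolvent p A0 z0 x) \<le> K * nrm x"
    using bop_bound[OF resolvent_bop[OF z0]] by blast
  \<comment> \<open>The change of z and the change of the operator contribute d each; K + 1 keeps
    the denominator positive and makes K times 2 d at most 1/2.\<close>
  define d where "d = 1 / (4 * (K + 1))"
  have d: "0 < d" "K * (2 * d) \<le> 1 / 2" using K(1) by (auto simp: d_def field_simps)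
  have "z \<notin> spectrum p A \<and> (\<forall>x\<in>lp p. nrm (resolvent p A z x) \<le> 2 * K * nrm x)"
    if A: "bop A" "\<And>x. x \<in> lp p \<Longrightarrow> nrm (\<lambda>n. A x n - A0 x n) \<le> d * nrm x" and z: "dist z z0 < d" for A z
  proof -
    define E where "E = (\<lambda>x n. (z0 - z) * x n + (A x n - A0 x n))"
    have E: "bop E" unfolding E_def by (rule bop_plus[OF bop_scalar bop_minus[OF A(1) A0]])
    have e: "nrm (E x) \<le> (2 * d) * nrm x" if x: "x \<in> lp p" for x
    proof -
      have "nrm (E x) \<le> nrm (\<lambda>n. (z0 - z) * x n) + nrm (\<lambda>n. A x n - A0 x n)"
        unfolding E_def by (intro lp_add lp_scale lp_diff bop_in_lp[OF A(1)] bop_in_lp[OF A0] x)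
      also have "\<dots> \<le> norm (z0 - z) * nrm x + d * nrm x"
        by (intro add_mono lp_scale(2) A x)
      also have "\<dots> \<le> d * nrm x + d * nrm x"
        using z by (intro add_right_mono mult_right_mono) (auto simp: dist_norm norm_minus_commute)
      finally show ?thesis by simp
    qed
    obtain B' where B': "inverse_pair (shifted z A) B'" "\<And>x. x \<in> lp p \<Longrightarrow> nrm (B' x) \<le> 2 * K * nrm x"
      by (rule inverse_pair_perturb[OF bop_shifted[OF A0] resolvent_inverse_pair[OF z0] E K e d(2), of "shifted z A"])
        (auto simp: shifted_def E_def fun_eq_iff algebra_simps)
    with resolvent_eq[OF B'(1)] show ?thesis by (auto simp: spectrum_iff)
  qed
  with d K that[of d "2 * K"] show thesis by auto
qed

lemma resolvent_local_bound:
  assumes A: "bop A" and z0: "z0 \<notin> spectrum p A"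
  obtains d M where "0 < d" "0 \<le> M" "\<And>z. dist z z0 < d \<Longrightarrow> z \<notin> spectrum p A"
    "\<And>z x. dist z z0 < d \<Longrightarrow> x \<in> lp p \<Longrightarrow> nrm (resolvent p A z x) \<le> M * nrm x"
proof -
  obtain d M where d: "0 < d" "0 \<le> M"
    "\<And>B z. bop B \<Longrightarrow> (\<And>x. x \<in> lp p \<Longrightarrow> nrm (\<lambda>n. B x n - A x n) \<le> d * nrm x) \<Longrightarrow> dist z z0 < d \<Longrightarrow>
       z \<notin> spectrum p B"
    "\<And>B z x. bop B \<Longrightarrow> (\<And>x. x \<in> lp p \<Longrightarrow> nrm (\<lambda>n. B x n - A x n) \<le> d * nrm x) \<Longrightarrow> dist z z0 < d \<Longrightarrow>
       x \<in> lp p \<Longrightarrow> nrm (resolvent p B z x) \<le> M * nrm x"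
    using resolvent_perturb[OF A z0] by blast
  show thesis by (rule that[OF d(1,2) d(3)[OF A] d(4)[OF A]]) (use d in auto)
qed

lemma spectrum_closed:
  assumes "bop A"
  shows "closed (spectrum p A)"
proof -
  have "open (- spectrum p A)"
    unfolding open_dist using resolvent_local_bound[OF assms] by (metis ComplD ComplI)
  then show ?thesis by (simp add: closed_open)
qed

lemma spectrum_bounded:
  assumes A: "bop A"
  obtains K where "\<And>z. K \<le> norm z \<Longrightarrow> z \<notin> spectrum p A"
proof -
  obtain K where K: "0 \<le> K" "\<And>x. x \<in> lp p \<Longrightarrow> nrm (A x) \<le> K * nrm x" using bop_bound[OF A] by blast
  \<comment> \<open>z I - A is a perturbation of z I, whose inverse has norm 1 / |z|. The bound
    makes z nonzero and K / |z| at most 1/2.\<close>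
  have "z \<notin> spectrum p A" if z: "2 * K + 1 \<le> norm z" for z
  proof -
    have nz: "z \<noteq> 0" using z K by auto
    have 1: "inverse_pair (\<lambda>x n. z * x n) (\<lambda>x n. (1 / z) * x n)"
      using bop_scalar[of "1 / z"] nz by (simp add: inverse_pair_def)
    obtain B' where "inverse_pair (shifted z A) B'"
    proof (rule inverse_pair_perturb[OF bop_scalar 1 A _ _ K(2), of "1 / norm z" "shifted z A"])
      show "nrm (\<lambda>n. 1 / z * x n) \<le> 1 / cmod z * nrm x" if "x \<in> lp p" for x
        using lp_scale(2)[OF that, of "1 / z"] by (simp add: norm_divide)
      show "1 / cmod z * K \<le> 1 / 2" using z K nz by (simp add: field_simps)
    qed (auto simp: shifted_def)
    then show ?thesis by (auto simp: spectrum_iff)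
  qed
  then show thesis using that by blast
qed

lemma resolvent_identity:
  assumes A: "bop A" and z: "z \<notin> spectrum p A" and w: "w \<notin> spectrum p A" and x: "x \<in> lp p"
  shows "resolvent p A z x n - resolvent p A w x n = (w - z) * resolvent p A z (resolvent p A w x) n"
proof -
  let ?R = "resolvent p A"
  have Rw: "?R w x \<in> lp p" by (rule resolvent_in_lp[OF w x])
  have "shifted z A (?R w x) = (\<lambda>n. shifted w A (?R w x) n + (z - w) * ?R w x n)"
    by (simp add: shifted_def algebra_simps)
  then have "?R z (shifted z A (?R w x)) = ?R z (\<lambda>n. x n + (z - w) * ?R w x n)"
    by (simp add: shifted_resolvent[OF w x])
  then have "?R w x = (\<lambda>n. ?R z x n + (z - w) * ?R z (?R w x) n)"
    using resolvent_shifted[OF z Rw] bop_add[OF resolvent_bop[OF z] x lp_scale(1)[OF Rw]]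
      bop_scale[OF resolvent_bop[OF z] Rw] by simp
  from fun_cong[OF this, of n] show ?thesis by (simp add: algebra_simps)
qed

lemma resolvent_lipschitz:
  assumes A: "bop A" and z0: "z0 \<notin> spectrum p A"
  obtains d M where "0 < d" "0 \<le> M" "\<And>z. dist z z0 < d \<Longrightarrow> z \<notin> spectrum p A"
    "\<And>z x. dist z z0 < d \<Longrightarrow> x \<in> lp p \<Longrightarrow>
       nrm (\<lambda>n. resolvent p A z x n - resolvent p A z0 x n) \<le> M * dist z z0 * nrm x"
proof -
  obtain d M where d: "0 < d" "0 \<le> M" "\<And>z. dist z z0 < d \<Longrightarrow> z \<notin> spectrum p A"
    "\<And>z x. dist z z0 < d \<Longrightarrow> x \<in> lp p \<Longrightarrow> nrm (resolvent p A z x) \<le> M * nrm x"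
    using resolvent_local_bound[OF A z0] by blast
  show thesis
  proof (rule that[OF d(1) _ d(3), of "M * M"])
    fix z x assume z: "dist z z0 < d" and x: "x \<in> lp p"
    let ?R = "resolvent p A"
    have R0: "?R z0 x \<in> lp p" by (rule resolvent_in_lp[OF z0 x])
    have "nrm (\<lambda>n. ?R z x n - ?R z0 x n) = nrm (\<lambda>n. (z0 - z) * ?R z (?R z0 x) n)"
      by (simp add: resolvent_identity[OF A d(3)[OF z] z0 x])
    also have "\<dots> \<le> norm (z0 - z) * nrm (?R z (?R z0 x))"
      by (intro lp_scale resolvent_in_lp d(3) z R0)
    also have "\<dots> \<le> norm (z0 - z) * (M * (M * nrm x))"
      using d(4)[OF z R0] mult_left_mono[OF d(4)[of z0, OF _ x] d(2)] d(1)
      by (intro mult_left_mono) auto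
    finally show "nrm (\<lambda>n. ?R z x n - ?R z0 x n) \<le> M * M * dist z z0 * nrm x"
      by (simp add: dist_norm norm_minus_commute algebra_simps)
  qed (use d in auto)
qed

text \<open>By the resolvent identity the difference quotient at w equals -R z (R w x). Continuity
  of the resolvent in each coordinate then yields the derivative -R w (R w x).\<close>

lemma resolvent_holomorphic:
  assumes A: "bop A" and x: "x \<in> lp p"
  shows "(\<lambda>z. resolvent p A z x n) holomorphic_on - spectrum p A"
proof -
  let ?R = "resolvent p A"
  have cont: "((\<lambda>z. ?R z y n) \<longlongrightarrow> ?R w y n) (at w)" if w: "w \<notin> spectrum p A" and y: "y \<in> lp p" for w y
  proof -
    obtain d M where d: "0 < d" "0 \<le> M" "\<And>z. dist z w < d \<Longrightarrow> z \<notin> spectrum p A"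
      "\<And>z x. dist z w < d \<Longrightarrow> x \<in> lp p \<Longrightarrow>
         nrm (\<lambda>n. resolvent p A z x n - resolvent p A w x n) \<le> M * dist z w * nrm x"
      using resolvent_lipschitz[OF A w] by blast
    have "((\<lambda>z. M * dist z w * nrm y) \<longlongrightarrow> M * dist w w * nrm y) (at w)"
      by (intro tendsto_intros)
    then have lim: "((\<lambda>z. M * dist z w * nrm y) \<longlongrightarrow> 0) (at w)" by simp
    have "((\<lambda>z. ?R z y n - ?R w y n) \<longlongrightarrow> 0) (at w)"
    proof (rule Lim_null_comparison[OF _ lim])
      show "\<forall>\<^sub>F z in at w. cmod (?R z y n - ?R w y n) \<le> M * dist z w * nrm y"
        unfolding eventually_at using d(1)
      proof (intro exI[of _ d] conjI ballI impI)
        fix z assume "z \<noteq> w \<and> dist z w < d"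
        then have z: "dist z w < d" by simp
        have "cmod (?R z y n - ?R w y n) \<le> nrm (\<lambda>n. ?R z y n - ?R w y n)"
          using norm_le_nrm[OF lp_diff(1)[OF resolvent_in_lp[OF d(3)[OF z] y] resolvent_in_lp[OF w y]]] .
        with d(4)[OF z y] show "cmod (?R z y n - ?R w y n) \<le> M * dist z w * nrm y" by simp
      qed
    qed
    then show ?thesis by (simp add: LIM_zero_iff)
  qed
  have "((\<lambda>z. ?R z x n) has_field_derivative - ?R w (?R w x) n) (at w)" if w: "w \<notin> spectrum p A" for w
    unfolding has_field_derivative_iff
  proof (rule Lim_transform_eventually)
    show "((\<lambda>z. - ?R z (?R w x) n) \<longlongrightarrow> - ?R w (?R w x) n) (at w)"
      by (intro tendsto_minus cont w resolvent_in_lp x)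
    have "\<forall>\<^sub>F z in at w. z \<in> - spectrum p A"
      using spectrum_closed[OF A] w by (intro eventually_at_in_open') (auto simp: open_Compl)
    then show "\<forall>\<^sub>F z in at w. - ?R z (?R w x) n = (?R z x n - ?R w x n) / (z - w)"
      using eventually_neq_at_within[of w w UNIV]
    proof eventually_elim
      case (elim z)
      then have "?R z x n - ?R w x n = (w - z) * ?R z (?R w x) n"
        using resolvent_identity[OF A _ w x, of z n] by auto
      with elim show ?case by (simp add: field_simps)
    qed
  qed
  then show ?thesis
    using spectrum_closed[OF A] by (intro holomorphic_onI) (auto simp: field_differentiable_def
        intro: has_field_derivative_at_within)
qed

section \<open>Operator-valued integrals\<close>

text \<open>A Riemann sum is a finite combination of elements of l_p with norm at most the length of
  the interval times C. If Riemann sums converge to the integral in every coordinate, the limit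
  inherits this bound.\<close>

lemma integral_in_lp:
  fixes g :: "real \<Rightarrow> seq"
  assumes cont: "\<And>n. continuous_on (cbox a b) (\<lambda>t. g t n)"
    and g: "\<And>t. t \<in> cbox a b \<Longrightarrow> g t \<in> lp p" "\<And>t. t \<in> cbox a b \<Longrightarrow> nrm (g t) \<le> C"
  shows "(\<lambda>n. integral (cbox a b) (\<lambda>t. g t n)) \<in> lp p"
    and "nrm (\<lambda>n. integral (cbox a b) (\<lambda>t. g t n)) \<le> measure lborel (cbox a b) * C"
proof -
  let ?I = "\<lambda>n. integral (cbox a b) (\<lambda>t. g t n)"
  have "((\<lambda>t. g t n) has_integral ?I n) (cbox a b)" for n
    using integrable_continuous[OF cont] by (rule integrable_integral)
  then have "\<exists>\<gamma>. gauge \<gamma> \<and> (\<forall>D. D tagged_division_of cbox a b \<and> \<gamma> fine D \<longrightarrow>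
      norm ((\<Sum>(t,k)\<in>D. measure lborel k *\<^sub>R g t n) - ?I n) < inverse (Suc j))" for n j :: nat
    unfolding has_integral by simp
  then obtain \<gamma> where \<gamma>: "\<And>n j. gauge (\<gamma> n j)" "\<And>n j D. D tagged_division_of cbox a b \<Longrightarrow> \<gamma> n j fine D \<Longrightarrow>
      norm ((\<Sum>(t,k)\<in>D. measure lborel k *\<^sub>R g t n) - ?I n) < inverse (Suc j)"
    by metis
  \<comment> \<open>Diagonal choice: the j-th division is fine for the gauges of the coordinates 0
    to j, so each fixed coordinate is controlled from some j on.\<close>
  have "\<exists>D. D tagged_division_of cbox a b \<and> (\<forall>n\<le>j. \<gamma> n j fine D)" for j
  proof -
    have "gauge (\<lambda>x. \<Inter>n\<in>{..j}. \<gamma> n j x)"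
      using \<gamma>(1) by (auto simp: gauge_def intro!: open_INT)
    from fine_division_exists[OF this] obtain D
      where "D tagged_division_of cbox a b" "(\<lambda>x. \<Inter>n\<in>{..j}. \<gamma> n j x) fine D" by blast
    then show ?thesis by (intro exI[of _ D]) (fastforce simp: fine_def)
  qed
  then obtain D where D: "\<And>j. D j tagged_division_of cbox a b" "\<And>j n. n \<le> j \<Longrightarrow> \<gamma> n j fine D j"
    by metis
  define S where "S j = (\<lambda>n. \<Sum>d\<in>D j. complex_of_real (measure lborel (snd d)) * g (fst d) n)" for j
  have mem: "g (fst d) \<in> lp p" "nrm (g (fst d)) \<le> C" if "d \<in> D j" for d j
    using tagged_division_ofD(2,3)[OF D(1)[of j], of "fst d" "snd d"] that g by auto
  have S_lp: "S j \<in> lp p" for j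
    unfolding S_def using tagged_division_ofD(1)[OF D(1)] by (intro lp_sum lp_scale mem)
  have S_nrm: "nrm (S j) \<le> measure lborel (cbox a b) * C" for j
  proof -
    have "nrm (S j) \<le> (\<Sum>d\<in>D j. nrm (\<lambda>n. complex_of_real (measure lborel (snd d)) * g (fst d) n))"
      unfolding S_def using tagged_division_ofD(1)[OF D(1)] by (intro lp_sum lp_scale mem)
    also have "\<dots> \<le> (\<Sum>d\<in>D j. measure lborel (snd d) * C)"
    proof (rule sum_mono)
      fix d assume d: "d \<in> D j"
      have "nrm (\<lambda>n. complex_of_real (measure lborel (snd d)) * g (fst d) n) \<le> measure lborel (snd d) * nrm (g (fst d))"
        using lp_scale(2)[OF mem(1)[OF d], of "complex_of_real (measure lborel (snd d))"] by simp
      also have "\<dots> \<le> measure lborel (snd d) * C" by (intro mult_left_mono mem[OF d]) simp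
      finally show "nrm (\<lambda>n. complex_of_real (measure lborel (snd d)) * g (fst d) n) \<le> measure lborel (snd d) * C" .
    qed
    also have "\<dots> = measure lborel (cbox a b) * C"
      using additive_content_tagged_division[OF D(1)[of j]]
      by (simp add: sum_distrib_right[symmetric] case_prod_unfold)
    finally show ?thesis .
  qed
  have S_lim: "(\<lambda>j. S j n) \<longlonglongrightarrow> ?I n" for n
  proof -
    have "\<forall>\<^sub>F j in sequentially. norm (S j n - ?I n) \<le> inverse (Suc j)"
      using eventually_ge_at_top[of n]
    proof eventually_elim
      case (elim j)
      from \<gamma>(2)[OF D(1) D(2)[OF elim]] show ?case
        by (simp add: S_def case_prod_unfold scaleR_conv_of_real)
    qed
    then have "(\<lambda>j. S j n - ?I n) \<longlonglongrightarrow> 0"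
      using LIMSEQ_inverse_real_of_nat by (rule Lim_null_comparison)
    then show ?thesis by (simp add: LIM_zero_iff)
  qed
  show "?I \<in> lp p" "nrm ?I \<le> measure lborel (cbox a b) * C"
    using lp_pointwise_limit[OF S_lp S_nrm S_lim] .
qed

text \<open>Continuity in operator norm gives a gauge that does not depend on x, which is what
  \<open>op_has_integral\<close> demands; coordinatewise integrability alone would give a gauge for
  each x and n.\<close>

lemma op_has_integral_continuous:
  fixes F :: "real \<Rightarrow> seq \<Rightarrow> seq"
  assumes F: "\<And>t. t \<in> {0..1} \<Longrightarrow> bop (F t)"
    and cont: "\<And>t e. t \<in> {0..1} \<Longrightarrow> 0 < e \<Longrightarrow> \<exists>d>0. \<forall>s\<in>{0..1}. dist s t < d \<longrightarrow>
        (\<forall>x\<in>lp p. nrm (\<lambda>n. F s x n - F t x n) \<le> e * nrm x)"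
  shows "op_has_integral p F (\<lambda>x n. integral {0..1} (\<lambda>t. F t x n)) 0 1"
proof -
  let ?P = "\<lambda>x n. integral {0..1} (\<lambda>t. F t x n)"
  have F_lp: "F t x \<in> lp p" if "x \<in> lp p" "t \<in> {0..1}" for x t
    using bop_in_lp[OF F] that by blast
  have coord: "continuous_on {0..1} (\<lambda>t. F t x n)" if x: "x \<in> lp p" for x n
  proof (clarsimp simp: continuous_on_iff)
    fix t e :: real assume t: "0 \<le> t" "t \<le> 1" and e: "0 < e"
    define e' where "e' = e / (2 * (nrm x + 1))"
    have e': "0 < e'" "e' * nrm x < e"
    proof -
      have pos: "0 < nrm x + 1" using nrm_nonneg[of x] by linarith
      then show "0 < e'" using e by (simp add: e'_def)
      have "nrm x < 2 * (nrm x + 1)" using pos by simp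
      with e have "e * nrm x < e * (2 * (nrm x + 1))" by (simp only: mult_strict_left_mono)
      then show "e' * nrm x < e" using pos by (simp add: e'_def divide_less_eq)
    qed
    from cont[OF _ e'(1), of t] t obtain d where "0 < d"
      "\<forall>s\<in>{0..1}. dist s t < d \<longrightarrow> (\<forall>x\<in>lp p. nrm (\<lambda>n. F s x n - F t x n) \<le> e' * nrm x)" by auto
    moreover have "norm (F s x n - F t x n) \<le> nrm (\<lambda>n. F s x n - F t x n)" if "s \<in> {0..1}" for s
      using norm_le_nrm[OF lp_diff(1)[OF F_lp[OF x that] F_lp[OF x, of t]]] t by simp
    ultimately show "\<exists>d>0. \<forall>s\<in>{0..1}. dist s t < d \<longrightarrow> dist (F s x n) (F t x n) < e"
      using x e'(2) by (intro exI[of _ d]) (fastforce simp: dist_norm)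
  qed
  have int: "(\<lambda>t. F t x n) integrable_on {0..1}" if "x \<in> lp p" for x n
    by (rule integrable_continuous_interval[OF coord[OF that]])
  define err where "err D x = (\<lambda>n. (\<Sum>(t,k)\<in>D. measure lborel k *\<^sub>R F t x n) - ?P x n)" for D :: "(real \<times> real set) set" and x
  have riemann: "\<exists>g. gauge g \<and> (\<forall>D. D tagged_division_of {0..1} \<and> g fine D \<longrightarrow> (\<forall>x\<in>lp p.
      err D x \<in> lp p \<and>
      nrm (err D x) \<le> e * nrm x))" if e: "0 < e" for e
  proof -
    obtain d where d: "\<And>t. t \<in> {0..1} \<Longrightarrow> 0 < d t" "\<And>t s x. t \<in> {0..1} \<Longrightarrow> s \<in> {0..1} \<Longrightarrow> dist s t < d t \<Longrightarrow>
        x \<in> lp p \<Longrightarrow> nrm (\<lambda>n. F s x n - F t x n) \<le> e * nrm x"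
      using cont[OF _ e] by metis
    \<comment> \<open>On a piece tagged by t the operators differ from F t by at most e in norm. The
      value 1 outside the interval only makes g a gauge on the whole line.\<close>
    define g where "g t = ball t (if t \<in> {0..1} then d t else 1)" for t :: real
    have "gauge g" using d(1) by (auto simp: gauge_def g_def)
    moreover have "err D x \<in> lp p \<and>
      nrm (err D x) \<le> e * nrm x"
      if D: "D tagged_division_of {0..1}" "g fine D" and x: "x \<in> lp p" for D x
    proof -
      have D': "D tagged_division_of cbox 0 1" using D(1) by simp
      \<comment> \<open>v q is the error on one tagged piece, written as an integral so that
        \<open>integral_in_lp\<close> bounds it by e times the length of the piece. The lengths add
        up to 1.\<close>
      define v where "v d = (\<lambda>n. integral (snd d) (\<lambda>s. F (fst d) x n - F s x n))" for d
      have piece: "v q \<in> lp p \<and> nrm (v q) \<le> measure lborel (snd q) * (e * nrm x) \<and>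
          (\<forall>n. v q n = measure lborel (snd q) *\<^sub>R F (fst q) x n - integral (snd q) (\<lambda>s. F s x n))"
        if dD: "q \<in> D" for q
      proof -
        obtain t k where tk: "q = (t, k)" by (cases q)
        from tagged_division_ofD(2,3,4)[OF D', of t k] dD tk obtain a b
          where ab: "k = cbox a b" "t \<in> k" "k \<subseteq> {0..1}" by auto
        have k: "s \<in> {0..1}" "dist s t < d t" if "s \<in> k" for s
          using fineD[OF D(2), of t k] dD tk ab that by (auto simp: g_def dist_commute)
        have t: "t \<in> {0..1}" using ab by auto
        have c: "continuous_on (cbox a b) (\<lambda>s. F s x n)" for n
          using continuous_on_subset[OF coord[OF x]] ab by blast
        have 1: "continuous_on (cbox a b) (\<lambda>s. F t x n - F s x n)" for n
          by (intro continuous_intros c)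
        have 2: "(\<lambda>n. F t x n - F s x n) \<in> lp p" if "s \<in> cbox a b" for s
          using that k(1) t ab by (intro lp_diff F_lp x) auto
        have 3: "nrm (\<lambda>n. F t x n - F s x n) \<le> e * nrm x" if "s \<in> cbox a b" for s
        proof -
          have s: "s \<in> k" using that ab by simp
          have "nrm (\<lambda>n. F t x n - F s x n) = nrm (\<lambda>n. F s x n - F t x n)"
            unfolding lp_norm_def by (simp add: norm_minus_commute)
          then show ?thesis using d(2)[OF t k(1)[OF s] k(2)[OF s] x] by simp
        qed
        have "integral (cbox a b) (\<lambda>s. F t x n - F s x n)
            = measure lborel (cbox a b) *\<^sub>R F t x n - integral (cbox a b) (\<lambda>s. F s x n)" for n
          by (subst Henstock_Kurzweil_Integration.integral_diff[OF
                integrable_continuous[OF continuous_on_const] integrable_continuous[OF c]]) simp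
        with integral_in_lp[of a b "\<lambda>s n. F t x n - F s x n", OF 1 2 3] show ?thesis
          by (simp add: v_def tk ab)
      qed
      have fin: "finite D" using D' by blast
      have eq: "err D x = (\<lambda>n. \<Sum>d\<in>D. v d n)"
        unfolding err_def
      proof
        fix n
        have "?P x n = (\<Sum>(t,k)\<in>D. integral k (\<lambda>s. F s x n))"
          using integral_combine_tagged_division_topdown[of "\<lambda>s. F s x n" 0 1 D] int[OF x] D' by simp
        then show "(\<Sum>(t,k)\<in>D. measure lborel k *\<^sub>R F t x n) - ?P x n = (\<Sum>d\<in>D. v d n)"
          using piece by (simp add: case_prod_unfold sum_subtractf[symmetric])
      qed
      have "nrm (\<lambda>n. \<Sum>d\<in>D. v d n) \<le> (\<Sum>d\<in>D. nrm (v d))" using lp_sum(2)[OF fin, of v] piece by blast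
      also have "\<dots> \<le> (\<Sum>d\<in>D. measure lborel (snd d) * (e * nrm x))" using piece by (intro sum_mono) auto
      also have "\<dots> = (\<Sum>(t,k)\<in>D. measure lborel k) * (e * nrm x)"
        by (simp add: sum_distrib_right case_prod_unfold)
      also have "\<dots> = e * nrm x" using additive_content_tagged_division[OF D'] by simp
      finally show ?thesis unfolding eq using lp_sum(1)[OF fin, of v] piece by blast
    qed
    ultimately show ?thesis by (intro exI[of _ g] conjI[of "gauge g"] allI impI ballI) auto
  qed
  \<comment> \<open>One Riemann sum S with error 1 suffices: P = S - (S - P) is bounded by the bound
    of S plus 1.\<close>
  have "bop ?P"
  proof -
    have "(0::real) < 1" by simp
    from riemann[OF this] obtain g where g: "gauge g \<and> (\<forall>D. D tagged_division_of {0..1} \<and> g fine D \<longrightarrow>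
        (\<forall>x\<in>lp p. err D x \<in> lp p \<and> nrm (err D x) \<le> 1 * nrm x))" ..
    obtain D where D: "D tagged_division_of {0..1}" "g fine D"
      using fine_division_exists_real[OF conjunct1[OF g]] by blast
    then have fin: "finite D" by blast
    define S where "S x = (\<lambda>n. \<Sum>d\<in>D. complex_of_real (measure lborel (snd d)) * F (fst d) x n)" for x
    have tD: "fst d \<in> {0..1}" if "d \<in> D" for d
      using tagged_division_ofD(2,3)[OF D(1), of "fst d" "snd d"] that by auto
    have "\<exists>K. \<forall>x\<in>lp p. nrm (F (fst d) x) \<le> K * nrm x" if "d \<in> D" for d
      using F[OF tD[OF that]] by (simp add: bounded_op_def)
    then obtain K where K: "\<And>d x. d \<in> D \<Longrightarrow> x \<in> lp p \<Longrightarrow> nrm (F (fst d) x) \<le> K d * nrm x"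
      by metis
    define L where "L = (\<Sum>d\<in>D. measure lborel (snd d) * K d)"
    have diff: "(\<lambda>n. S x n - ?P x n) \<in> lp p" "nrm (\<lambda>n. S x n - ?P x n) \<le> nrm x" if "x \<in> lp p" for x
      using g D that by (auto simp: err_def S_def case_prod_unfold scaleR_conv_of_real)
    have S: "S x \<in> lp p" "nrm (S x) \<le> L * nrm x" if x: "x \<in> lp p" for x
    proof -
      have mem: "(\<lambda>n. complex_of_real (measure lborel (snd d)) * F (fst d) x n) \<in> lp p" if "d \<in> D" for d
        by (intro lp_scale F_lp x tD that)
      show "S x \<in> lp p" unfolding S_def by (intro lp_sum fin mem)
      have "nrm (S x) \<le> (\<Sum>d\<in>D. nrm (\<lambda>n. complex_of_real (measure lborel (snd d)) * F (fst d) x n))"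
        unfolding S_def by (intro lp_sum fin mem)
      also have "\<dots> \<le> (\<Sum>d\<in>D. measure lborel (snd d) * K d * nrm x)"
      proof (rule sum_mono)
        fix d assume d: "d \<in> D"
        have "nrm (\<lambda>n. complex_of_real (measure lborel (snd d)) * F (fst d) x n)
            \<le> measure lborel (snd d) * nrm (F (fst d) x)"
          using lp_scale(2)[OF F_lp[OF x tD[OF d]], of "complex_of_real (measure lborel (snd d))"] by simp
        also have "\<dots> \<le> measure lborel (snd d) * (K d * nrm x)"
          by (intro mult_left_mono K d x) simp
        finally show "nrm (\<lambda>n. complex_of_real (measure lborel (snd d)) * F (fst d) x n)
            \<le> measure lborel (snd d) * K d * nrm x" by simp
      qed
      finally show "nrm (S x) \<le> L * nrm x" by (simp add: L_def sum_distrib_right)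
    qed
    have P_eq: "?P x = (\<lambda>n. S x n - (S x n - ?P x n))" for x by simp
    show ?thesis
    proof (rule bopI[of _ "L + 1"])
      fix x assume x: "x \<in> lp p"
      show "?P x \<in> lp p" by (subst P_eq, intro lp_diff(1) S diff x)
      have "nrm (?P x) \<le> nrm (S x) + nrm (\<lambda>n. S x n - ?P x n)"
        by (subst P_eq, intro lp_diff(2) S diff x)
      then show "nrm (?P x) \<le> (L + 1) * nrm x"
        using S(2)[OF x] diff(2)[OF x] by (simp add: algebra_simps)
      fix z
      have "integral {0..1} (\<lambda>t. F t (\<lambda>n. z * x n) n) = integral {0..1} (\<lambda>t. z * F t x n)" for n
        by (rule integral_cong) (simp add: bop_scale[OF F x])
      then show "?P (\<lambda>n. z * x n) = (\<lambda>n. z * ?P x n)" by simp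
    next
      fix x y assume x: "x \<in> lp p" and y: "y \<in> lp p"
      have "integral {0..1} (\<lambda>t. F t (\<lambda>n. x n + y n) n) = integral {0..1} (\<lambda>t. F t x n + F t y n)" for n
        by (rule integral_cong) (simp add: bop_add[OF F x y])
      then show "?P (\<lambda>n. x n + y n) = (\<lambda>n. ?P x n + ?P y n)"
        by (simp add: Henstock_Kurzweil_Integration.integral_add[OF int[OF x] int[OF y]])
    qed
  qed
  moreover have "\<exists>g. gauge g \<and> (\<forall>D. D tagged_division_of {0..1} \<and> g fine D \<longrightarrow> (\<forall>x\<in>lp p.
      nrm (err D x) \<le> e * nrm x))" if "0 < e" for e
  proof -
    from riemann[OF that] obtain g where g: "gauge g \<and> (\<forall>D. D tagged_division_of {0..1} \<and> g fine D \<longrightarrow>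
        (\<forall>x\<in>lp p. err D x \<in> lp p \<and> nrm (err D x) \<le> e * nrm x))" ..
    then show ?thesis by (intro exI[of _ g]) auto
  qed
  ultimately show ?thesis unfolding op_has_integral_def err_def using F by blast
qed

end

section \<open>Finite-rank perturbations\<close>

lemma sum_indicator_mult:
  fixes a :: complex and i :: nat
  assumes "i < M"
  shows "(\<Sum>k<M. (if i = k then a else 0) * u k) = a * u i"
proof -
  have "(\<Sum>k<M. (if i = k then a else 0) * u k) = (\<Sum>k<M. if i = k then a * u k else 0)"
    by (intro sum.cong) auto
  with assms show ?thesis by simp
qed

context lp_exponent
begin

lemma bop_rank_one:
  assumes A: "bop A" and v: "v \<in> lp p"
  shows "bop (\<lambda>x n. A x k * v n)"
proof -
  obtain K where K: "0 \<le> K" "\<And>x. x \<in> lp p \<Longrightarrow> nrm (A x) \<le> K * nrm x" using bop_bound[OF A] by blast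
  show ?thesis
  proof (rule bopI[of _ "K * nrm v"])
    fix x assume x: "x \<in> lp p"
    show "(\<lambda>n. A x k * v n) \<in> lp p" by (rule lp_scale(1)[OF v])
    have "nrm (\<lambda>n. A x k * v n) \<le> norm (A x k) * nrm v" by (rule lp_scale(2)[OF v])
    also have "\<dots> \<le> (K * nrm x) * nrm v"
      using norm_le_nrm[OF bop_in_lp[OF A x], of k] K(2)[OF x] by (intro mult_right_mono) auto
    finally show "nrm (\<lambda>n. A x k * v n) \<le> K * nrm v * nrm x" by (simp add: mult_ac)
  qed (auto simp: bop_add[OF A] bop_scale[OF A] algebra_simps)
qed

lemma bop_sum_ops:
  assumes "finite S" "\<And>i. i \<in> S \<Longrightarrow> bop (A i)"
  shows "bop (\<lambda>x n. \<Sum>i\<in>S. A i x n)"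
  using assms
proof (induction S rule: finite_induct)
  case empty
  show ?case using bop_scalar[of 0] by simp
next
  case (insert i S)
  then show ?case using bop_plus[of "A i" "\<lambda>x n. \<Sum>i\<in>S. A i x n"] by simp
qed

text \<open>With R the resolvent of A, the equation (z - T) x = y becomes x = R y + sum of x_j R
  f_j. Reading it at the coordinates i < M leaves a square system for the first M entries of x, with
  matrix D; the remaining entries then follow.\<close>

lemma finite_rank_perturbation_resolvent:
  assumes A: "bop A" and T: "bop T" and f: "\<And>j. j < M \<Longrightarrow> f j \<in> lp p"
    and T_eq: "\<And>x. x \<in> lp p \<Longrightarrow> T x = (\<lambda>n. A x n + (\<Sum>j<M. x j * f j n))"
    and S: "S \<subseteq> - spectrum p A"
  obtains d where "d holomorphic_on S"
    "\<And>z. z \<in> S \<Longrightarrow> z \<in> spectrum p T \<longleftrightarrow> d z = 0"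
    "\<And>x n. x \<in> lp p \<Longrightarrow> \<exists>h. h holomorphic_on S \<and>
        (\<forall>z\<in>S. d z \<noteq> 0 \<longrightarrow> d z * resolvent p T z x n = h z)"
proof -
  define R where "R = resolvent p A"
  define D where "D z i j = (if i = j then 1 else 0) - R z (f j) i" for z i j
  have hol: "(\<lambda>z. R z x n) holomorphic_on S" if "x \<in> lp p" for x n
    unfolding R_def using resolvent_holomorphic[OF A that] S by (rule holomorphic_on_subset)
  have R: "bop (R z)" "\<And>x. x \<in> lp p \<Longrightarrow> R z x \<in> lp p"
    "\<And>x. x \<in> lp p \<Longrightarrow> R z (shifted z A x) = x" "\<And>x. x \<in> lp p \<Longrightarrow> shifted z A (R z x) = x" if "z \<in> S" for z
    using that S resolvent_bop resolvent_in_lp resolvent_shifted shifted_resolvent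
    by (auto simp: R_def)
  have D_hol: "(\<lambda>z. D z i j) holomorphic_on S" if "i < M" "j < M" for i j
    unfolding D_def using that by (intro holomorphic_intros hol f)
  obtain d C where d: "d holomorphic_on S"
    and C_hol: "\<And>i j. i < M \<Longrightarrow> j < M \<Longrightarrow> (\<lambda>z. C z i j) holomorphic_on S"
    and DC: "\<And>z i k. i < M \<Longrightarrow> k < M \<Longrightarrow> (\<Sum>j<M. D z i j * C z j k) = (if i = k then d z else 0)"
    and CD: "\<And>z i k. i < M \<Longrightarrow> k < M \<Longrightarrow> (\<Sum>j<M. C z i j * D z j k) = (if i = k then d z else 0)"
    and ker: "\<And>z. d z = 0 \<Longrightarrow> \<exists>\<xi>. (\<exists>i<M. \<xi> i \<noteq> 0) \<and> (\<forall>i<M. (\<Sum>j<M. D z i j * \<xi> j) = 0)"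
    using holomorphic_adjugate[of M D S] D_hol by blast
  \<comment> \<open>Cramer's rule: \<xi> solves D \<xi> = (head of R y) and is the intended head of
    the solution B z y.\<close>
  define \<xi> where "\<xi> z y j = (\<Sum>k<M. C z j k * R z y k) / d z" for z y j
  define B where "B z y = (\<lambda>n. R z y n + (\<Sum>j<M. \<xi> z y j * R z (f j) n))" for z y
  have shT: "shifted z T x = (\<lambda>n. shifted z A x n - (\<Sum>j<M. x j * f j n))" if "x \<in> lp p" for x z
    using T_eq[OF that] by (simp add: shifted_def algebra_simps)
  have sum_D: "(\<Sum>j<M. D z i j * u j) = u i - (\<Sum>j<M. u j * R z (f j) i)" if "i < M" for z i u
  proof -
    have "(\<Sum>j<M. D z i j * u j) = (\<Sum>j<M. (if i = j then u j else 0) - u j * R z (f j) i)"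
      by (intro sum.cong) (auto simp: D_def algebra_simps)
    then show ?thesis using that by (simp add: sum_subtractf)
  qed
  have inv: "inverse_pair (shifted z T) (B z)" if z: "z \<in> S" and dz: "d z \<noteq> 0" for z
    unfolding inverse_pair_def
  proof (intro conjI ballI)
    have "B z = (\<lambda>y n. R z y n + (\<Sum>j<M. \<Sum>k<M. (C z j k / d z) * (R z y k * R z (f j) n)))"
      by (simp add: B_def \<xi>_def sum_distrib_left sum_distrib_right sum_divide_distrib fun_eq_iff mult_ac)
    moreover have "bop (\<lambda>y n. R z y n + (\<Sum>j<M. \<Sum>k<M. (C z j k / d z) * (R z y k * R z (f j) n)))"
      by (intro bop_plus R bop_sum_ops bop_scaled bop_rank_one f z) auto
    ultimately show "bop (B z)" by simp
    fix x assume x: "x \<in> lp p"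
    have "D z i j * \<xi> z x j = (\<Sum>k<M. D z i j * C z j k * R z x k) / d z" for i j
      by (simp add: \<xi>_def sum_distrib_left mult_ac)
    then have "(\<Sum>j<M. D z i j * \<xi> z x j) = (\<Sum>k<M. (\<Sum>j<M. D z i j * C z j k) * R z x k) / d z" for i
      by (simp add: sum_divide_distrib[symmetric] sum_distrib_right) (subst sum.swap, simp)
    then have D\<xi>: "(\<Sum>j<M. D z i j * \<xi> z x j) = R z x i" if "i < M" for i
      using that dz by (simp add: DC sum_indicator_mult)
    \<comment> \<open>Consistency: the entries assumed for the solution are the entries it has, so
      the correction term in \<open>shT\<close> cancels.\<close>
    then have Bi: "B z x i = \<xi> z x i" if "i < M" for i
      using sum_D[OF that, of z "\<xi> z x"] that by (simp add: B_def)
    have Rf: "R z (f j) \<in> lp p" if "j < M" for j using R(2)[OF z f[OF that]] .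
    have sumlp: "(\<lambda>n. \<Sum>j<M. u j * R z (f j) n) \<in> lp p" for u
      by (intro lp_sum lp_scale Rf) auto
    have Blp: "B z x \<in> lp p"
      unfolding B_def by (intro lp_add R z x sumlp)
    note shA = bop_shifted[OF A, of z]
    have "shifted z A (B z x) = (\<lambda>n. x n + (\<Sum>j<M. \<xi> z x j * f j n))"
    proof -
      have "shifted z A (\<lambda>n. \<Sum>j<M. \<xi> z x j * R z (f j) n) = (\<lambda>n. \<Sum>j<M. \<xi> z x j * f j n)"
        using bop_sum[OF shA, of "{..<M}" "\<lambda>j n. \<xi> z x j * R z (f j) n"] lp_scale(1)[OF Rf]
        by (simp add: bop_scale[OF shA Rf] R(4)[OF z f])
      then show ?thesis
        unfolding B_def by (simp add: bop_add[OF shA R(2)[OF z x] sumlp] R(4)[OF z x])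
    qed
    then show "shifted z T (B z x) = x"
      by (simp add: shT[OF Blp] Bi)
    let ?y = "shifted z T x"
    have sumf: "(\<lambda>n. \<Sum>j<M. x j * f j n) \<in> lp p" by (intro lp_sum lp_scale f) auto
    have Ry: "R z ?y = (\<lambda>n. x n - (\<Sum>j<M. x j * R z (f j) n))"
    proof -
      have "R z (\<lambda>n. \<Sum>j<M. x j * f j n) = (\<lambda>n. \<Sum>j<M. x j * R z (f j) n)"
        using bop_sum[OF R(1)[OF z], of "{..<M}" "\<lambda>j n. x j * f j n"] lp_scale(1)[OF f]
        by (simp add: bop_scale[OF R(1)[OF z] f])
      then show ?thesis
        by (simp add: shT[OF x] bop_diff[OF R(1)[OF z] bop_in_lp[OF shA x] sumf] R(3)[OF z x])
    qed
    have "\<xi> z ?y j = x j" if j: "j < M" for j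
    proof -
      have "(\<Sum>k<M. C z j k * R z ?y k) = (\<Sum>k<M. \<Sum>l<M. C z j k * D z k l * x l)"
        using sum_D[of _ z x] by (intro sum.cong) (simp_all add: Ry sum_distrib_left[symmetric] mult.assoc)
      also have "\<dots> = (\<Sum>l<M. (\<Sum>k<M. C z j k * D z k l) * x l)"
        by (subst sum.swap) (simp add: sum_distrib_right)
      also have "\<dots> = d z * x j" using j by (simp add: CD sum_indicator_mult)
      finally show ?thesis using dz by (simp add: \<xi>_def)
    qed
    then show "B z ?y = x" by (simp add: B_def Ry)
  qed
  show thesis
  proof (rule that[OF d])
    fix z assume z: "z \<in> S"
    have "z \<in> spectrum p T" if "d z = 0"
    proof (rule ccontr)
      assume nz: "z \<notin> spectrum p T"
      from ker[OF that] obtain u where u: "\<exists>i<M. u i \<noteq> 0" "\<And>i. i < M \<Longrightarrow> (\<Sum>j<M. D z i j * u j) = 0"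
        by blast
      \<comment> \<open>A kernel vector u of D is the head of this x, which is therefore nonzero and
        satisfies (z - T) x = 0.\<close>
      define x where "x = (\<lambda>n. \<Sum>j<M. u j * R z (f j) n)"
      have Rf: "R z (f j) \<in> lp p" if "j < M" for j using R(2)[OF z f[OF that]] .
      have x: "x \<in> lp p" unfolding x_def by (intro lp_sum lp_scale Rf) auto
      have xi: "x i = u i" if "i < M" for i using sum_D[OF that, of z u] u(2)[OF that] by (simp add: x_def)
      note shA = bop_shifted[OF A, of z]
      have "shifted z A x = (\<lambda>n. \<Sum>j<M. u j * f j n)"
        unfolding x_def using bop_sum[OF shA, of "{..<M}" "\<lambda>j n. u j * R z (f j) n"] lp_scale(1)[OF Rf]
        by (simp add: bop_scale[OF shA Rf] R(4)[OF z f])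
      then have "shifted z T x = (\<lambda>n. 0)" by (simp add: shT[OF x] xi)
      then have "x = (\<lambda>n. 0)"
        using resolvent_shifted[OF nz x] bop_zero[OF resolvent_bop[OF nz]] by simp
      with u(1) xi show False by (metis)
    qed
    then show "z \<in> spectrum p T \<longleftrightarrow> d z = 0" using inv[OF z] spectrum_iff[of z T] by blast
  next
    fix x n assume x: "x \<in> lp p"
    \<comment> \<open>This is d times B with the division by d carried out in \<xi>, hence
      holomorphic across the zeros of d.\<close>
    define h where "h z = d z * R z x n + (\<Sum>j<M. (\<Sum>k<M. C z j k * R z x k) * R z (f j) n)" for z
    have "h holomorphic_on S"
      unfolding h_def by (intro holomorphic_intros d hol f C_hol x) auto
    moreover have "d z * resolvent p T z x n = h z" if z: "z \<in> S" and dz: "d z \<noteq> 0" for z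
      using dz by (simp add: resolvent_eq[OF inv[OF z dz] x] B_def h_def \<xi>_def distrib_left sum_distrib_left)
    ultimately show "\<exists>h. h holomorphic_on S \<and> (\<forall>z\<in>S. d z \<noteq> 0 \<longrightarrow> d z * resolvent p T z x n = h z)"
      by blast
  qed
qed

section \<open>Compact perturbations and the meromorphic resolvent\<close>

definition finite_rank_correction :: "(seq \<Rightarrow> seq) \<Rightarrow> (seq \<Rightarrow> seq) \<Rightarrow> nat \<Rightarrow> (nat \<Rightarrow> seq) \<Rightarrow> bool" where
  "finite_rank_correction T A M f \<longleftrightarrow>
     (\<forall>j<M. f j \<in> lp p) \<and> (\<forall>x\<in>lp p. T x = (\<lambda>n. A x n + (\<Sum>j<M. x j * f j n)))"

definition op_close :: "real \<Rightarrow> (seq \<Rightarrow> seq) \<Rightarrow> (seq \<Rightarrow> seq) \<Rightarrow> bool" where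
  "op_close e A B \<longleftrightarrow> (\<forall>x\<in>lp p. nrm (\<lambda>n. A x n - B x n) \<le> e * nrm x)"

text \<open>T - T0 is a norm limit of finite-rank operators, hence compact. The form is sharper than
  compactness: the correction sees finitely many entries of x, and f j is the j-th column of T -
  A.\<close>

definition compactly_near :: "(seq \<Rightarrow> seq) \<Rightarrow> (seq \<Rightarrow> seq) \<Rightarrow> bool" where
  "compactly_near T0 T \<longleftrightarrow>
     (\<forall>e>0. \<exists>A M f. bop A \<and> op_close e A T0 \<and> finite_rank_correction T A M f)"

text \<open>First the radius \<delta> is taken from T0 and z0, then an A within \<delta> of T0. The
  whole disc thereby avoids the spectrum of A, and T differs from A by the finite-rank
  correction.\<close>

lemma local_spectral_function:
  assumes T0: "bop T0" and T: "bop T" and near: "compactly_near T0 T" and z0: "z0 \<notin> spectrum p T0"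
  obtains \<delta> d where "0 < \<delta>" "d holomorphic_on ball z0 \<delta>"
    "\<And>z. z \<in> ball z0 \<delta> \<Longrightarrow> z \<in> spectrum p T \<longleftrightarrow> d z = 0"
    "\<And>x n. x \<in> lp p \<Longrightarrow> \<exists>h. h holomorphic_on ball z0 \<delta> \<and>
        (\<forall>z\<in>ball z0 \<delta>. d z \<noteq> 0 \<longrightarrow> d z * resolvent p T z x n = h z)"
proof -
  obtain \<delta> where \<delta>: "0 < \<delta>"
    "\<And>A z. bop A \<Longrightarrow> (\<And>x. x \<in> lp p \<Longrightarrow> nrm (\<lambda>n. A x n - T0 x n) \<le> \<delta> * nrm x) \<Longrightarrow> dist z z0 < \<delta> \<Longrightarrow>
       z \<notin> spectrum p A"
    using resolvent_perturb[OF T0 z0] by metis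
  from near \<delta>(1) obtain A M f
    where "bop A" "op_close \<delta> A T0" "finite_rank_correction T A M f"
    unfolding compactly_near_def by blast
  then have A: "bop A" "\<And>x. x \<in> lp p \<Longrightarrow> nrm (\<lambda>n. A x n - T0 x n) \<le> \<delta> * nrm x"
    "\<And>j. j < M \<Longrightarrow> f j \<in> lp p" "\<And>x. x \<in> lp p \<Longrightarrow> T x = (\<lambda>n. A x n + (\<Sum>j<M. x j * f j n))"
    by (simp_all add: op_close_def finite_rank_correction_def)
  have S: "ball z0 \<delta> \<subseteq> - spectrum p A"
    using \<delta>(2)[OF A(1,2)] by (auto simp: dist_commute)
  from finite_rank_perturbation_resolvent[OF A(1) T A(3,4) S] that \<delta>(1) show thesis by metis
qed

text \<open>The exponent m is chosen before x and n: it is the order of d at z0, and d is a common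
  denominator of all coordinates of the resolvent.\<close>

lemma meromorphic_resolvent:
  assumes T0: "bop T0" and T: "bop T" and near: "compactly_near T0 T"
    and conn: "connected (- spectrum p T0)" and z0: "z0 \<notin> spectrum p T0"
  obtains r m where "0 < r" "\<And>z. z \<in> cball z0 r - {z0} \<Longrightarrow> z \<notin> spectrum p T"
    "\<And>x n. x \<in> lp p \<Longrightarrow> \<exists>h. h holomorphic_on cball z0 r \<and>
        (\<forall>z\<in>cball z0 r - {z0}. (z - z0) ^ m * resolvent p T z x n = h z)"
proof -
  obtain \<delta> d where \<delta>: "0 < \<delta>" and d: "d holomorphic_on ball z0 \<delta>"
    "\<And>z. z \<in> ball z0 \<delta> \<Longrightarrow> z \<in> spectrum p T \<longleftrightarrow> d z = 0"
    "\<And>x n. x \<in> lp p \<Longrightarrow> \<exists>h. h holomorphic_on ball z0 \<delta> \<and>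
        (\<forall>z\<in>ball z0 \<delta>. d z \<noteq> 0 \<longrightarrow> d z * resolvent p T z x n = h z)"
    using local_spectral_function[OF T0 T near z0] by metis
  have "\<exists>w\<in>ball z0 \<delta>. d w \<noteq> 0"
  proof (rule ccontr)
    assume "\<not> ?thesis"
    then have sub: "ball z0 \<delta> \<subseteq> spectrum p T" using d(2) by blast
    define X where "X = - spectrum p T0"
    \<comment> \<open>If d vanished on the disc, z0 would lie in U. U is open, and it is closed in X
      because a local determinant that vanishes on a nonempty open part of its disc vanishes on all
      of it.\<close>
    define U where "U = X \<inter> interior (spectrum p T)"
    have "z0 \<in> U" unfolding U_def X_def using z0 sub \<delta> by (auto simp: mem_interior)
    moreover have "openin (top_of_set X) U"
      unfolding U_def by (rule openin_open_Int) simp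
    moreover have "closedin (top_of_set X) U"
      unfolding closedin_limpt
    proof (intro conjI allI impI)
      show "U \<subseteq> X" by (simp add: U_def)
      fix z1 assume z1: "z1 islimpt U \<and> z1 \<in> X"
      then have "z1 \<notin> spectrum p T0" by (simp add: X_def)
      from local_spectral_function[OF T0 T near this] obtain \<delta>1 d1 where \<delta>1: "0 < \<delta>1"
        "d1 holomorphic_on ball z1 \<delta>1" "\<And>z. z \<in> ball z1 \<delta>1 \<Longrightarrow> z \<in> spectrum p T \<longleftrightarrow> d1 z = 0"
        by metis
      let ?V = "ball z1 \<delta>1 \<inter> interior (spectrum p T)"
      from z1 \<delta>1(1) obtain y where "y \<in> U" "y \<in> ball z1 \<delta>1"
        unfolding islimpt_def by (metis centre_in_ball open_ball)
      then have "?V \<noteq> {}" by (auto simp: U_def)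
      moreover have "d1 z = 0" if "z \<in> ?V" for z using \<delta>1(3)[of z] that interior_subset by auto
      ultimately have "d1 z = 0" if "z \<in> ball z1 \<delta>1" for z
        using analytic_continuation_open[of ?V "ball z1 \<delta>1" d1 "\<lambda>_. 0" z] \<delta>1(2) that by auto
      then have "ball z1 \<delta>1 \<subseteq> spectrum p T" using \<delta>1(3) by auto
      then show "z1 \<in> U" using \<delta>1(1) z1 by (auto simp: U_def mem_interior)
    qed
    ultimately have "U = X" using conn unfolding connected_clopen X_def by blast
    obtain K where K: "\<And>z. K \<le> norm z \<Longrightarrow> z \<notin> spectrum p T" using spectrum_bounded[OF T] by blast
    obtain K0 where K0: "\<And>z. K0 \<le> norm z \<Longrightarrow> z \<notin> spectrum p T0" using spectrum_bounded[OF T0] by blast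
    \<comment> \<open>A real point beyond both spectra: it lies in X but not in U. The maximum with
      0 makes its modulus equal to the number itself.\<close>
    let ?z = "complex_of_real (max 0 (max K K0))"
    have "?z \<in> X" unfolding X_def using K0[of ?z] by simp
    moreover have "?z \<notin> U" using K[of ?z] interior_subset[of "spectrum p T"] by (auto simp: U_def le_max_iff_disj)
    ultimately show False using \<open>U = X\<close> by simp
  qed
  \<comment> \<open>Splitting off the zero of d leaves g without zeros on the closed disc, so h / g
    is holomorphic there. The order m is 0 when d does not vanish at z0.\<close>
  from zorder_exist_zero[OF d(1) open_ball connected_ball _ this] \<delta> obtain r g m where
    r: "0 < r" "cball z0 r \<subseteq> ball z0 \<delta>" "g holomorphic_on cball z0 r"
    "\<And>w. w \<in> cball z0 r \<Longrightarrow> d w = g w * (w - z0) ^ m \<and> g w \<noteq> 0"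
    by (metis centre_in_ball)
  have dnz: "d z \<noteq> 0" if "z \<in> cball z0 r - {z0}" for z using r(4)[of z] that by auto
  show thesis
  proof (rule that[OF r(1)])
    show "z \<notin> spectrum p T" if "z \<in> cball z0 r - {z0}" for z
      using d(2)[of z] dnz[OF that] that r(2) by auto
    fix x n assume "x \<in> lp p"
    from d(3)[OF this, of n] obtain h where h: "h holomorphic_on ball z0 \<delta>"
      "\<And>z. z \<in> ball z0 \<delta> \<Longrightarrow> d z \<noteq> 0 \<Longrightarrow> d z * resolvent p T z x n = h z" by blast
    have "(\<lambda>z. h z / g z) holomorphic_on cball z0 r"
      using r(4) by (intro holomorphic_intros holomorphic_on_subset[OF h(1) r(2)] r(3)) auto
    moreover have "(z - z0) ^ m * resolvent p T z x n = h z / g z" if "z \<in> cball z0 r - {z0}" for z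
    proof -
      have "g z * (z - z0) ^ m * resolvent p T z x n = h z" "g z \<noteq> 0"
        using h(2)[OF _ dnz[OF that]] r(2,4) that by auto
      then show ?thesis by (simp add: field_simps)
    qed
    ultimately show "\<exists>h. h holomorphic_on cball z0 r \<and>
        (\<forall>z\<in>cball z0 r - {z0}. (z - z0) ^ m * resolvent p T z x n = h z)" by blast
  qed
qed

end

section \<open>Riesz projections\<close>

text \<open>A subspace on which the first N entries determine a sequence has dimension at most N.
  The proof eliminates one entry at a time, and S stays inside V so that it later lies in
  \<open>lp p\<close>.\<close>

lemma finite_spanning_set:
  fixes V :: "seq set"
  assumes "\<And>x y. x \<in> V \<Longrightarrow> y \<in> V \<Longrightarrow> (\<lambda>n. x n - y n) \<in> V"
    and "\<And>c x. x \<in> V \<Longrightarrow> (\<lambda>n. c * x n) \<in> V"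
    and "\<And>x. x \<in> V \<Longrightarrow> (\<And>n. n < N \<Longrightarrow> x n = 0) \<Longrightarrow> x = (\<lambda>n. 0)"
  shows "\<exists>S. finite S \<and> S \<subseteq> V \<and> (\<forall>x\<in>V. \<exists>u. x = (\<lambda>n. \<Sum>s\<in>S. u s * s n))"
  using assms
proof (induction N arbitrary: V)
  case 0
  then show ?case by (intro exI[of _ "{}"]) auto
next
  case (Suc N)
  define V' where "V' = {x \<in> V. x N = 0}"
  have "\<exists>S. finite S \<and> S \<subseteq> V' \<and> (\<forall>x\<in>V'. \<exists>u. x = (\<lambda>n. \<Sum>s\<in>S. u s * s n))"
  proof (rule Suc.IH)
    fix x assume "x \<in> V'" "\<And>n. n < N \<Longrightarrow> x n = 0"
    then show "x = (\<lambda>n. 0)" using Suc.prems(3)[of x] by (auto simp: V'_def less_Suc_eq)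
  qed (auto simp: V'_def Suc.prems)
  then obtain S where S: "finite S" "S \<subseteq> V'" "\<And>x. x \<in> V' \<Longrightarrow> \<exists>u. x = (\<lambda>n. \<Sum>s\<in>S. u s * s n)"
    by blast
  show ?case
  proof (cases "\<forall>x\<in>V. x N = 0")
    case True
    then have "V' = V" by (auto simp: V'_def)
    with S show ?thesis by blast
  next
    case False
    then obtain e where e: "e \<in> V" "e N \<noteq> 0" by blast
    \<comment> \<open>Normalized to w N = 1, so that x - x N w falls into V'.\<close>
    define w where "w = (\<lambda>n. (1 / e N) * e n)"
    have w: "w \<in> V" "w N = 1" using Suc.prems(2)[OF e(1), of "1 / e N"] e(2) by (simp_all only: w_def) simp
    have "w \<notin> S" using S(2) w by (auto simp: V'_def)
    have "\<exists>u. x = (\<lambda>n. \<Sum>s\<in>insert w S. u s * s n)" if x: "x \<in> V" for x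
    proof -
      have "(\<lambda>n. x n - x N * w n) \<in> V'"
        using Suc.prems(1)[OF x Suc.prems(2)[OF w(1)]] w by (simp add: V'_def)
      then obtain u where u: "(\<lambda>n. x n - x N * w n) = (\<lambda>n. \<Sum>s\<in>S. u s * s n)" using S(3) by blast
      define u' where "u' = u(w := x N)"
      have "(\<Sum>s\<in>S. u' s * s n) = (\<Sum>s\<in>S. u s * s n)" for n
        using \<open>w \<notin> S\<close> by (intro sum.cong) (auto simp: u'_def)
      then have "(\<Sum>s\<in>insert w S. u' s * s n) = x N * w n + (x n - x N * w n)" for n
        using fun_cong[OF u, of n] by (simp add: sum.insert[OF S(1) \<open>w \<notin> S\<close>]) (simp add: u'_def)
      then have "x = (\<lambda>n. \<Sum>s\<in>insert w S. u' s * s n)" by simp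
      then show ?thesis by blast
    qed
    then show ?thesis using S(1,2) w by (intro exI[of _ "insert w S"]) (auto simp: V'_def)
  qed
qed

context lp_exponent
begin

text \<open>With finite rows, T acts on each coordinate as a finite sum and passes through
  coordinatewise integrals by linearity.\<close>

definition row_finite :: "(seq \<Rightarrow> seq) \<Rightarrow> bool" where
  "row_finite T \<longleftrightarrow> (\<forall>n. \<exists>S u. finite S \<and> (\<forall>x\<in>lp p. T x n = (\<Sum>k\<in>S. u k * x k)))"

end

locale isolated_circle = lp_exponent +
  fixes T :: "seq \<Rightarrow> seq" and z0 :: complex and r :: real
  assumes T: "bounded_op p T" and T_rows: "row_finite T"
    and r: "0 < r" and circle: "sphere z0 r \<inter> spectrum p T = {}"
begin

abbreviation R :: "complex \<Rightarrow> seq \<Rightarrow> seq" where "R \<equiv> resolvent p T"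

text \<open>The Riesz-Dunford integral of f times the resolvent, divided by 2 pi i and taken
  coordinate by coordinate; \<open>weighted_op_integral\<close> shows that it is also the integral
  in operator norm.\<close>

definition weighted_integral :: "(complex \<Rightarrow> complex) \<Rightarrow> seq \<Rightarrow> seq" where
  "weighted_integral f x = (\<lambda>n. contour_integral (circlepath z0 r) (\<lambda>z. f z / (2 * of_real pi * \<i>) * R z x n))"

lemma on_circle: "z \<in> sphere z0 r \<Longrightarrow> z \<notin> spectrum p T"
  using circle by auto

lemma circle_path_image: "path_image (circlepath z0 r) = sphere z0 r"
  using r by simp

lemma resolvent_continuous_on_circle:
  assumes "x \<in> lp p"
  shows "continuous_on (sphere z0 r) (\<lambda>z. R z x n)"
  using holomorphic_on_imp_continuous_on[OF resolvent_holomorphic[OF T assms]]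
  by (rule continuous_on_subset) (use circle in auto)

lemma weighted_integrable:
  assumes "continuous_on (sphere z0 r) f" "x \<in> lp p"
  shows "(\<lambda>z. f z / (2 * of_real pi * \<i>) * R z x n) contour_integrable_on circlepath z0 r"
  unfolding circle_path_image[symmetric]
  by (intro contour_integrable_continuous_circlepath continuous_intros)
     (use assms circle_path_image resolvent_continuous_on_circle in simp_all)

lemma weighted_op_integral:
  assumes f: "continuous_on (sphere z0 r) f"
  shows "op_has_contour_integral p (\<lambda>z x n. f z / (2 * of_real pi * \<i>) * R z x n)
     (weighted_integral f) (circlepath z0 r)"
proof -
  let ?\<gamma> = "circlepath z0 r"
  \<comment> \<open>k collects all scalar factors: f, the factor 1 / (2 pi i) and the derivative of
    the circle.\<close>
  define k where "k t = f (?\<gamma> t) / (2 * of_real pi * \<i>) * (2 * pi * \<i> * r * exp (2 * of_real pi * \<i> * t))"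
    for t :: real
  have \<gamma>: "?\<gamma> t \<in> sphere z0 r" if "t \<in> {0..1}" for t
    using that circle_path_image unfolding path_image_def by blast
  note sp = on_circle[OF \<gamma>]
  have \<gamma>_cont: "continuous_on {0..1} ?\<gamma>"
    using path_circlepath[of z0 r] by (simp add: path_def)
  have k_cont: "continuous_on {0..1} k"
    unfolding k_def
    by (intro continuous_intros continuous_on_compose2[OF f \<gamma>_cont]) (use \<gamma> in auto)
  have vd: "vector_derivative ?\<gamma> (at t within {0..1}) = 2 * pi * \<i> * r * exp (2 * of_real pi * \<i> * t)"
    if "t \<in> {0..1}" for t using that by (simp add: vector_derivative_circlepath01)
  define F where "F t x n = f (?\<gamma> t) / (2 * of_real pi * \<i>) * R (?\<gamma> t) x n
      * vector_derivative ?\<gamma> (at t within {0..1})" for t x n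
  have F_eq: "F t x = (\<lambda>n. k t * R (?\<gamma> t) x n)" if "t \<in> {0..1}" for t x
    by (simp add: F_def vd[OF that] k_def fun_eq_iff mult_ac)
  have "op_has_integral p F (\<lambda>x n. integral {0..1} (\<lambda>t. F t x n)) 0 1"
  proof (rule op_has_integral_continuous)
    show "bop (F t)" if "t \<in> {0..1}" for t
      using bop_scaled[OF resolvent_bop[OF sp[OF that]], of "k t"] F_eq[OF that] by presburger
    fix t e :: real assume t: "t \<in> {0..1}" and e: "0 < e"
    obtain d M where d: "0 < d" "0 \<le> M" "\<And>z. dist z (?\<gamma> t) < d \<Longrightarrow> z \<notin> spectrum p T"
      "\<And>z x. dist z (?\<gamma> t) < d \<Longrightarrow> x \<in> lp p \<Longrightarrow>
         nrm (\<lambda>n. R z x n - R (?\<gamma> t) x n) \<le> M * dist z (?\<gamma> t) * nrm x"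
      using resolvent_lipschitz[OF T sp[OF t]] by blast
    obtain L where L: "0 \<le> L" "\<And>x. x \<in> lp p \<Longrightarrow> nrm (R (?\<gamma> t) x) \<le> L * nrm x"
      using bop_bound[OF resolvent_bop[OF sp[OF t]]] by blast
    \<comment> \<open>\<phi> s bounds the operator norm of F s - F t for s near t: the first term
      varies the resolvent, the second the scalar factor. It is continuous and vanishes at
      t.\<close>
    define \<phi> where "\<phi> s = norm (k s) * (M * dist (?\<gamma> s) (?\<gamma> t)) + norm (k s - k t) * L" for s
    have "continuous_on {0..1} \<phi>"
      unfolding \<phi>_def by (intro continuous_intros k_cont \<gamma>_cont)
    then have "\<exists>d>0. \<forall>s\<in>{0..1}. dist s t < d \<longrightarrow> dist (\<phi> s) (\<phi> t) < e"
      using t e unfolding continuous_on_iff by blast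
    moreover have "\<phi> t = 0" by (simp add: \<phi>_def)
    ultimately obtain d1 where d1: "0 < d1" "\<And>s. s \<in> {0..1} \<Longrightarrow> dist s t < d1 \<Longrightarrow> \<bar>\<phi> s\<bar> < e"
      by (auto simp: dist_norm)
    obtain d2 where d2: "0 < d2" "\<And>s. s \<in> {0..1} \<Longrightarrow> dist s t < d2 \<Longrightarrow> dist (?\<gamma> s) (?\<gamma> t) < d"
      using \<gamma>_cont t d(1) unfolding continuous_on_iff by metis
    show "\<exists>\<delta>>0. \<forall>s\<in>{0..1}. dist s t < \<delta> \<longrightarrow> (\<forall>x\<in>lp p. nrm (\<lambda>n. F s x n - F t x n) \<le> e * nrm x)"
    proof (intro exI[of _ "min d1 d2"] conjI ballI impI)
      show "0 < min d1 d2" using d1 d2 by simp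
      fix s x assume s: "s \<in> {0..1}" "dist s t < min d1 d2" and x: "x \<in> lp p"
      note Rs = resolvent_in_lp[OF sp[OF s(1)] x] and Rt = resolvent_in_lp[OF sp[OF t] x]
      let ?D = "\<lambda>n. F s x n - F t x n"
      have "?D = (\<lambda>n. k s * (R (?\<gamma> s) x n - R (?\<gamma> t) x n) + (k s - k t) * R (?\<gamma> t) x n)"
        by (simp add: F_eq[OF s(1)] F_eq[OF t] algebra_simps)
      then have "nrm ?D \<le> norm (k s) * nrm (\<lambda>n. R (?\<gamma> s) x n - R (?\<gamma> t) x n) + norm (k s - k t) * nrm (R (?\<gamma> t) x)"
        using lp_add(2)[OF lp_scale(1)[OF lp_diff(1)[OF Rs Rt], of "k s"] lp_scale(1)[OF Rt, of "k s - k t"]]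
          lp_scale(2)[OF lp_diff(1)[OF Rs Rt], of "k s"] lp_scale(2)[OF Rt, of "k s - k t"] by simp
      also have "\<dots> \<le> norm (k s) * (M * dist (?\<gamma> s) (?\<gamma> t) * nrm x) + norm (k s - k t) * (L * nrm x)"
        using d(4)[OF d2(2) x] s L(2)[OF x] by (intro add_mono mult_left_mono) auto
      also have "\<dots> = \<phi> s * nrm x" by (simp add: \<phi>_def algebra_simps)
      also have "\<dots> \<le> e * nrm x" using d1(2)[OF s(1)] s by (intro mult_right_mono) auto
      finally show "nrm ?D \<le> e * nrm x" .
    qed
  qed
  moreover have "integral {0..1} (\<lambda>t. F t x n) = weighted_integral f x n" for x n
    unfolding weighted_integral_def contour_integral_integral
    by (rule integral_cong) (simp add: F_def vector_derivative_circlepath vd)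
  ultimately show ?thesis
    unfolding op_has_contour_integral_def F_def by simp
qed

lemma weighted_bop: "continuous_on (sphere z0 r) f \<Longrightarrow> bop (weighted_integral f)"
  using weighted_op_integral by (simp add: op_has_contour_integral_def op_has_integral_def)

lemma weighted_cong:
  assumes "\<And>z. z \<in> sphere z0 r \<Longrightarrow> f z = g z"
  shows "weighted_integral f = weighted_integral g"
  unfolding weighted_integral_def
  by (intro ext contour_integral_eq) (simp only: circle_path_image assms)

text \<open>On the circle T R z = z R z - I; integrating against f produces the term c times x.
  Below c is 0 for powers of z - z0 and 1 for 1 / (z - z0).\<close>

lemma T_weighted:
  assumes f: "continuous_on (sphere z0 r) f" and x: "x \<in> lp p"
    and f_int: "contour_integral (circlepath z0 r) f = 2 * of_real pi * \<i> * c"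
  shows "T (weighted_integral f x) n = weighted_integral (\<lambda>z. z * f z) x n - c * x n"
proof -
  let ?\<gamma> = "circlepath z0 r" and ?c = "2 * of_real pi * \<i>"
  obtain S u where S: "finite S" "\<And>y. y \<in> lp p \<Longrightarrow> T y n = (\<Sum>k\<in>S. u k * y k)"
    using T_rows unfolding row_finite_def by metis
  have cancel: "w \<noteq> 0 \<Longrightarrow> y / w * (w * v) = v * y" for w y v :: complex by simp
  have zf: "continuous_on (sphere z0 r) (\<lambda>z. z * f z)" by (intro continuous_intros f)
  have Tr: "T (R z x) n = z * R z x n - x n" if "z \<in> sphere z0 r" for z
    using fun_cong[OF shifted_resolvent[OF on_circle[OF that] x], of n] by (simp add: shifted_def algebra_simps)
  have "T (weighted_integral f x) n = (\<Sum>k\<in>S. u k * weighted_integral f x k)"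
    by (rule S(2)[OF bop_in_lp[OF weighted_bop[OF f] x]])
  also have "\<dots> = contour_integral ?\<gamma> (\<lambda>z. \<Sum>k\<in>S. u k * (f z / ?c * R z x k))"
    unfolding weighted_integral_def
    by (simp only: contour_integral_sum[OF S(1)] contour_integral_lmul contour_integrable_lmul
        weighted_integrable[OF f x])
  also have "\<dots> = contour_integral ?\<gamma> (\<lambda>z. (z * f z) / ?c * R z x n - x n / ?c * f z)"
  proof (rule contour_integral_eq)
    fix z assume "z \<in> path_image ?\<gamma>"
    then have z: "z \<in> sphere z0 r" by (simp only: circle_path_image)
    have "(\<Sum>k\<in>S. u k * (f z / ?c * R z x k)) = f z / ?c * T (R z x) n"
      unfolding S(2)[OF resolvent_in_lp[OF on_circle[OF z] x]] sum_distrib_left by (simp add: mult_ac)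
    then show "(\<Sum>k\<in>S. u k * (f z / ?c * R z x k)) = (z * f z) / ?c * R z x n - x n / ?c * f z"
      by (simp add: Tr[OF z] algebra_simps diff_divide_distrib)
  qed
  also have "\<dots> = weighted_integral (\<lambda>z. z * f z) x n - contour_integral ?\<gamma> (\<lambda>z. x n / ?c * f z)"
    unfolding weighted_integral_def
    by (intro contour_integral_diff weighted_integrable zf x contour_integrable_lmul
        contour_integrable_continuous_circlepath) (use f circle_path_image in simp)
  also have "contour_integral ?\<gamma> (\<lambda>z. x n / ?c * f z) = x n / ?c * (?c * c)"
    by (subst contour_integral_lmul[OF contour_integrable_continuous_circlepath])
       (use f circle_path_image in \<open>simp_all only: f_int\<close>)
  also have "\<dots> = c * x n"
    using cancel[of ?c "x n" c] by simp
  finally show ?thesis .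
qed

lemma weighted_add:
  assumes "continuous_on (sphere z0 r) f" "continuous_on (sphere z0 r) g" "x \<in> lp p"
  shows "weighted_integral (\<lambda>z. a * f z + b * g z) x n = a * weighted_integral f x n + b * weighted_integral g x n"
proof -
  have "weighted_integral (\<lambda>z. a * f z + b * g z) x n = contour_integral (circlepath z0 r)
      (\<lambda>z. a * (f z / (2 * of_real pi * \<i>) * R z x n) + b * (g z / (2 * of_real pi * \<i>) * R z x n))"
    unfolding weighted_integral_def by (rule contour_integral_eq) (simp add: field_simps)
  also have "\<dots> = a * weighted_integral f x n + b * weighted_integral g x n"
    unfolding weighted_integral_def
    by (simp only: contour_integral_add contour_integral_lmul contour_integrable_lmul
        weighted_integrable[OF assms(1,3)] weighted_integrable[OF assms(2,3)])
  finally show ?thesis .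
qed

text \<open>When the punctured disc avoids the spectrum, this is the coefficient of the power -(j +
  1) of z - z0 in the Laurent series of the resolvent; j = 0 is the Riesz projection.\<close>

definition laurent_op :: "nat \<Rightarrow> seq \<Rightarrow> seq" where
  "laurent_op j = weighted_integral (\<lambda>z. (z - z0) ^ j)"

lemma laurent_bop: "bop (laurent_op j)"
  unfolding laurent_op_def by (intro weighted_bop continuous_intros)

lemma T_laurent:
  assumes x: "x \<in> lp p"
  shows "T (laurent_op j x) n - z0 * laurent_op j x n = laurent_op (Suc j) x n"
proof -
  have "((\<lambda>z. (z - z0) ^ j) has_contour_integral 0) (circlepath z0 r)"
    by (rule Cauchy_theorem_convex_simple[of _ UNIV]) (auto intro!: holomorphic_intros)
  then have "contour_integral (circlepath z0 r) (\<lambda>z. (z - z0) ^ j) = 2 * of_real pi * \<i> * 0"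
    using contour_integral_unique by fastforce
  moreover have "continuous_on (sphere z0 r) (\<lambda>z. (z - z0) ^ j)" by (intro continuous_intros)
  ultimately have "T (laurent_op j x) n = weighted_integral (\<lambda>z. z * (z - z0) ^ j) x n"
    using T_weighted[OF _ x, of "\<lambda>z. (z - z0) ^ j" 0 n] unfolding laurent_op_def by simp
  moreover have "weighted_integral (\<lambda>z. z * (z - z0) ^ j) x n
      = weighted_integral (\<lambda>z. 1 * (z - z0) ^ Suc j + z0 * (z - z0) ^ j) x n"
    by (rule fun_cong[OF fun_cong[OF weighted_cong]]) (simp add: algebra_simps)
  moreover have "\<dots> = 1 * laurent_op (Suc j) x n + z0 * laurent_op j x n"
    unfolding laurent_op_def by (intro weighted_add x continuous_intros)
  ultimately show ?thesis by simp
qed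

lemma laurent_op_zero:
  assumes "x \<in> lp p" "h holomorphic_on cball z0 r"
    and "\<And>z. z \<in> sphere z0 r \<Longrightarrow> (z - z0) ^ m * R z x n = h z"
  shows "laurent_op m x n = 0"
proof -
  have "((\<lambda>z. h z / (2 * of_real pi * \<i>)) has_contour_integral 0) (circlepath z0 r)"
    by (rule Cauchy_theorem_convex_simple[of _ "cball z0 r"])
       (use assms(2) r in \<open>auto intro!: holomorphic_intros\<close>)
  moreover have "laurent_op m x n = contour_integral (circlepath z0 r) (\<lambda>z. h z / (2 * of_real pi * \<i>))"
    unfolding laurent_op_def weighted_integral_def
    by (rule contour_integral_eq)
       (simp only: circle_path_image assms(3)[symmetric] times_divide_eq_left)
  ultimately show ?thesis using contour_integral_unique by simp
qed

text \<open>The inverse is the constant Laurent coefficient B, the integral with f z = 1 / (z - z0).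
  In general (z0 - T) B and B (z0 - T) both equal I - Q 0. For a point of the spectrum this makes Q
  0 nonzero, the starting point for an eigenvector.\<close>

lemma zero_projection_imp_regular:
  assumes P0: "\<And>x. x \<in> lp p \<Longrightarrow> laurent_op 0 x = (\<lambda>n. 0)"
  shows "z0 \<notin> spectrum p T"
proof -
  define f where "f z = 1 / (z - z0)" for z
  have nz: "z - z0 \<noteq> 0" if "z \<in> sphere z0 r" for z using that r by auto
  have f: "continuous_on (sphere z0 r) f"
    unfolding f_def by (intro continuous_intros) (use nz in auto)
  have fi: "contour_integral (circlepath z0 r) f = 2 * of_real pi * \<i> * 1"
  proof -
    have "f = (\<lambda>z. 1 / (z - z0))" by (simp add: f_def fun_eq_iff)
    then show ?thesis using contour_integral_circlepath[OF r, of z0] by (simp only: mult_1_right)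
  qed
  define B where "B = weighted_integral f"
  have zf: "weighted_integral (\<lambda>z. z * f z) x n = z0 * B x n" if x: "x \<in> lp p" for x n
  proof -
    have "weighted_integral (\<lambda>z. z * f z) x n = weighted_integral (\<lambda>z. 1 * (z - z0) ^ 0 + z0 * f z) x n"
    proof (rule fun_cong[OF fun_cong[OF weighted_cong]])
      fix z assume "z \<in> sphere z0 r"
      from nz[OF this] show "z * f z = 1 * (z - z0) ^ 0 + z0 * f z" by (simp add: f_def field_simps)
    qed
    also have "\<dots> = 1 * laurent_op 0 x n + z0 * B x n"
      unfolding laurent_op_def B_def by (intro weighted_add x continuous_intros f)
    finally show ?thesis by (simp add: P0[OF x])
  qed
  have "inverse_pair (shifted z0 T) B"
    unfolding inverse_pair_def
  proof (intro conjI ballI)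
    show B: "bop B" unfolding B_def by (rule weighted_bop[OF f])
    fix x assume x: "x \<in> lp p"
    show "shifted z0 T (B x) = x"
      unfolding shifted_def using T_weighted[OF f x fi] zf[OF x] by (simp add: B_def)
    show "B (shifted z0 T x) = x"
    proof
      fix n
      have sx: "shifted z0 T x \<in> lp p" by (rule bop_in_lp[OF bop_shifted[OF T] x])
      have R_eq: "R z (shifted z0 T x) n = x n - (z - z0) * R z x n" if z: "z \<in> sphere z0 r" for z
      proof -
        note zs = on_circle[OF z]
        have "shifted z0 T x = (\<lambda>n. shifted z T x n - (z - z0) * x n)"
          by (simp add: shifted_def algebra_simps)
        then show ?thesis
          using bop_diff[OF resolvent_bop[OF zs] bop_in_lp[OF bop_shifted[OF T, of z] x] lp_scale(1)[OF x, of "z - z0"]]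
          by (simp add: bop_scale[OF resolvent_bop[OF zs] x] resolvent_shifted[OF zs x])
      qed
      have "B (shifted z0 T x) n = contour_integral (circlepath z0 r)
          (\<lambda>z. x n / (2 * of_real pi * \<i>) * f z - (z - z0) ^ 0 / (2 * of_real pi * \<i>) * R z x n)"
        unfolding B_def weighted_integral_def
      proof (rule contour_integral_eq)
        fix z assume "z \<in> path_image (circlepath z0 r)"
        then have z: "z \<in> sphere z0 r" by (simp only: circle_path_image)
        show "f z / (2 * of_real pi * \<i>) * R z (shifted z0 T x) n
            = x n / (2 * of_real pi * \<i>) * f z - (z - z0) ^ 0 / (2 * of_real pi * \<i>) * R z x n"
          using nz[OF z] by (simp add: R_eq[OF z] f_def field_simps)
      qed
      also have "\<dots> = contour_integral (circlepath z0 r) (\<lambda>z. x n / (2 * of_real pi * \<i>) * f z) - laurent_op 0 x n"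
        unfolding laurent_op_def weighted_integral_def
        by (intro contour_integral_diff weighted_integrable x contour_integrable_lmul continuous_intros
            contour_integrable_continuous_circlepath) (use f circle_path_image in simp)
      also have "contour_integral (circlepath z0 r) (\<lambda>z. x n / (2 * of_real pi * \<i>) * f z) = x n"
        by (subst contour_integral_lmul[OF contour_integrable_continuous_circlepath])
           (use f circle_path_image fi in simp_all)
      finally show "B (shifted z0 T x) n = x n" by (simp add: P0[OF x])
    qed
  qed
  then show ?thesis using spectrum_iff[of z0 T] by blast
qed

text \<open>\<open>reach\<close> says that T - z0 looks two entries ahead, \<open>ker\<close> that
  an eigenvector is determined by the entries 0, 1 and 2. Together they bound the dimension of the
  range of Q 0 in terms of the pole order m.\<close>

lemma finite_type_eigenvalueI:
  assumes z0: "z0 \<in> spectrum p T" and iso: "cball z0 r \<inter> spectrum p T = {z0}"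
    and pole: "\<And>x n. x \<in> lp p \<Longrightarrow> \<exists>h. h holomorphic_on cball z0 r \<and>
        (\<forall>z\<in>cball z0 r - {z0}. (z - z0) ^ m * R z x n = h z)"
    and reach: "\<And>x y N. x \<in> lp p \<Longrightarrow> y = (\<lambda>n. T x n - z0 * x n) \<Longrightarrow>
        (\<And>n. n < N + 2 \<Longrightarrow> x n = 0) \<Longrightarrow> (\<And>n. n < N \<Longrightarrow> y n = 0)"
    and ker: "\<And>x. x \<in> lp p \<Longrightarrow> (\<And>n. T x n = z0 * x n) \<Longrightarrow> (\<And>n. n < 3 \<Longrightarrow> x n = 0) \<Longrightarrow> x = (\<lambda>n. 0)"
  shows "finite_type_eigenvalue p T z0"
proof -
  let ?Q = laurent_op
  have Q_lp: "?Q j x \<in> lp p" if "x \<in> lp p" for j x by (rule bop_in_lp[OF laurent_bop that])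
  have Q_step: "?Q (Suc j) x = (\<lambda>n. T (?Q j x) n - z0 * ?Q j x n)" if "x \<in> lp p" for j x
    using T_laurent[OF that] by auto
  have Q_m: "?Q m x = (\<lambda>n. 0)" if x: "x \<in> lp p" for x
  proof
    fix n
    from pole[OF x, of n] obtain h where h: "h holomorphic_on cball z0 r"
      "\<And>z. z \<in> cball z0 r - {z0} \<Longrightarrow> (z - z0) ^ m * R z x n = h z" by blast
    show "?Q m x n = 0" by (rule laurent_op_zero[OF x h(1)]) (rule h(2), use r in auto)
  qed
  have ev: "eigenvalue p T z0"
  proof -
    obtain x where x: "x \<in> lp p" "?Q 0 x \<noteq> (\<lambda>n. 0)" using zero_projection_imp_regular z0 by blast
    \<comment> \<open>The first vanishing term of the chain Q 0 x, Q 1 x, and so on; T - z0 sends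
      its predecessor to 0.\<close>
    define j where "j = (LEAST j. ?Q j x = (\<lambda>n. 0))"
    have j: "?Q j x = (\<lambda>n. 0)" unfolding j_def by (rule LeastI[of _ m]) (rule Q_m[OF x(1)])
    with x(2) obtain i where i: "j = Suc i" by (cases j) auto
    have "?Q i x \<noteq> (\<lambda>n. 0)" using not_less_Least[of i "\<lambda>j. ?Q j x = (\<lambda>n. 0)"] i by (simp add: j_def)
    moreover have "T (?Q i x) = (\<lambda>n. z0 * ?Q i x n)"
      using Q_step[OF x(1), of i] j i by (auto simp: fun_eq_iff)
    ultimately show ?thesis unfolding eigenvalue_def using Q_lp[OF x(1)] by blast
  qed
  \<comment> \<open>2 m + 1 counts the index 0 and two entries for each of the m applications of T -
    z0. Descending from Q 0 to Q (m - 1), two vanishing entries are lost per step, so three remain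
    at the end, as \<open>ker\<close> requires.\<close>
  have inj: "?Q 0 x = (\<lambda>n. 0)" if x: "x \<in> lp p" and low: "\<And>n. n < 2 * m + 1 \<Longrightarrow> ?Q 0 x n = 0" for x
  proof -
    have "\<forall>n < 2 * (m - j) + 1. ?Q j x n = 0" if "j \<le> m" for j
      using that
    proof (induction j)
      case 0
      then show ?case using low by simp
    next
      case (Suc j)
      then have "\<And>n. n < (2 * (m - Suc j) + 1) + 2 \<Longrightarrow> ?Q j x n = 0" by auto
      from reach[OF Q_lp[OF x] Q_step[OF x] this] show ?case by blast
    qed
    then have low': "?Q j x n = 0" if "j < m" "n < 3" for j n using that by fastforce
    \<comment> \<open>Backwards from Q m x = 0: once a term vanishes, its predecessor is in the
      kernel of T - z0 with three vanishing entries, hence vanishes.\<close>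
    have "?Q (m - i) x = (\<lambda>n. 0)" if "i \<le> m" for i
      using that
    proof (induction i)
      case 0
      then show ?case by (simp add: Q_m[OF x])
    next
      case (Suc i)
      then have eq: "?Q (Suc (m - Suc i)) x = (\<lambda>n. 0)" by (simp add: Suc_diff_Suc)
      show ?case
      proof (rule ker[OF Q_lp[OF x]])
        show "T (?Q (m - Suc i) x) n = z0 * ?Q (m - Suc i) x n" for n
          using Q_step[OF x, of "m - Suc i"] eq by (auto simp: fun_eq_iff)
        show "?Q (m - Suc i) x n = 0" if "n < 3" for n using low' that Suc by simp
      qed
    qed
    from this[of m] show ?thesis by simp
  qed
  have fr: "finite_rank p (?Q 0)"
  proof -
    let ?V = "?Q 0 ` lp p"
    have "\<exists>S. finite S \<and> S \<subseteq> ?V \<and> (\<forall>x\<in>?V. \<exists>u. x = (\<lambda>n. \<Sum>s\<in>S. u s * s n))"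
    proof (rule finite_spanning_set[of ?V "2 * m + 1"])
      show "(\<lambda>n. x n - y n) \<in> ?V" if "x \<in> ?V" "y \<in> ?V" for x y
        using that by (auto simp: bop_diff[OF laurent_bop, symmetric] lp_diff)
      show "(\<lambda>n. c * x n) \<in> ?V" if "x \<in> ?V" for x c
        using that by (auto simp: bop_scale[OF laurent_bop, symmetric] lp_scale)
      show "x = (\<lambda>n. 0)" if "x \<in> ?V" "\<And>n. n < 2 * m + 1 \<Longrightarrow> x n = 0" for x
        using that inj by auto
    qed
    then obtain S where "finite S" "S \<subseteq> ?V" "\<forall>x\<in>?V. \<exists>u. x = (\<lambda>n. \<Sum>s\<in>S. u s * s n)" by (elim exE conjE)
    then show ?thesis unfolding finite_rank_def using Q_lp by (intro exI[of _ S]) auto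
  qed
  have riesz: "is_riesz_projection p T z0 r (?Q 0)"
  proof -
    have "continuous_on (sphere z0 r) (\<lambda>z. (z - z0) ^ 0)" by (intro continuous_intros)
    from weighted_op_integral[OF this] show ?thesis
      unfolding is_riesz_projection_def laurent_op_def by (simp only: power_0)
  qed
  have isolated: "z0 isolated_in spectrum p T"
    unfolding isolated_in_def
  proof (intro conjI exI[of _ "ball z0 r"] z0 open_ball equalityI)
    show "ball z0 r \<inter> spectrum p T \<subseteq> {z0}"
      unfolding iso[symmetric] by (intro Int_mono ball_subset_cball order_refl)
    show "{z0} \<subseteq> ball z0 r \<inter> spectrum p T" using z0 r by simp
  qed
  have "\<exists>P. is_riesz_projection p T z0 r P \<and> finite_rank p P"
    by (rule exI, rule conjI[OF riesz fr])
  with r iso have "\<exists>r>0. cball z0 r \<inter> spectrum p T = {z0} \<and>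
      (\<exists>P. is_riesz_projection p T z0 r P \<and> finite_rank p P)"
    by (intro exI[of _ r] conjI)
  with ev isolated show ?thesis unfolding finite_type_eigenvalue_def by (intro conjI)
qed

end

section \<open>Jacobi operators of step two\<close>

definition parity_seq :: "real \<Rightarrow> real \<Rightarrow> seq" where
  "parity_seq u v n = of_real (if odd n then u else v)"

text \<open>As an instance of \<open>op_T\<close>, the operator T0 shares all estimates with T, and
  their difference is again of the form \<open>op_T\<close>.\<close>

lemma op_T0_eq: "op_T0 r1 s1 r2 s2 = op_T (parity_seq r1 r2) (parity_seq s1 s2) (parity_seq s1 s2)"
  by (auto simp: op_T0_def op_T_def parity_seq_def Let_def fun_eq_iff)

lemma op_T_add: "op_T a b c (\<lambda>n. x n + y n) = (\<lambda>n. op_T a b c x n + op_T a b c y n)"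
  by (auto simp: op_T_def fun_eq_iff algebra_simps)

lemma op_T_scale: "op_T a b c (\<lambda>n. z * x n) = (\<lambda>n. z * op_T a b c x n)"
  by (auto simp: op_T_def fun_eq_iff algebra_simps)

lemma op_T_diff_coeffs:
  "op_T a b c x n - op_T a' b' c' x n = op_T (\<lambda>n. a n - a' n) (\<lambda>n. b n - b' n) (\<lambda>n. c n - c' n) x n"
  by (simp add: op_T_def algebra_simps)

context lp_exponent
begin

lemma op_T_bound:
  assumes A: "\<And>n. norm (a n) \<le> A" and B: "\<And>n. norm (b n) \<le> B" and C: "\<And>n. norm (c n) \<le> C"
    and x: "x \<in> lp p"
  shows "op_T a b c x \<in> lp p" and "nrm (op_T a b c x) \<le> (A + B + C) * nrm x"
proof -
  have nonneg: "0 \<le> A" "0 \<le> B" "0 \<le> C"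
    using order_trans[OF norm_ge_zero A] order_trans[OF norm_ge_zero B] order_trans[OF norm_ge_zero C] by auto
  define y1 where "y1 n = (if n \<le> 2 then 0 else c (n - 2) * x (n - 2))" for n
  define y2 where "y2 n = (if n = 0 then 0 else a n * x n)" for n
  define y3 where "y3 n = (if n = 0 then 0 else b n * x (n + 2))" for n
  have 1: "y1 \<in> lp p" "nrm y1 \<le> C * nrm x"
    by (rule lp_dominated[OF x nonneg(3), of y1 "\<lambda>n. n - 2"];
        auto simp: y1_def norm_mult C mult_right_mono inj_on_def split: if_splits)+
  have 2: "y2 \<in> lp p" "nrm y2 \<le> A * nrm x"
    by (rule lp_dominated[OF x nonneg(1), of y2 "\<lambda>n. n"];
        auto simp: y2_def norm_mult A mult_right_mono split: if_splits)+
  have 3: "y3 \<in> lp p" "nrm y3 \<le> B * nrm x"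
    by (rule lp_dominated[OF x nonneg(2), of y3 "\<lambda>n. n + 2"];
        auto simp: y3_def norm_mult B mult_right_mono inj_on_def split: if_splits)+
  have eq: "op_T a b c x = (\<lambda>n. (y1 n + y2 n) + y3 n)"
    by (auto simp: op_T_def y1_def y2_def y3_def fun_eq_iff)
  show "op_T a b c x \<in> lp p" unfolding eq by (intro lp_add 1 2 3)
  have "nrm (op_T a b c x) \<le> nrm y1 + nrm y2 + nrm y3"
    unfolding eq using lp_add(2)[OF lp_add(1)[OF 1(1) 2(1)] 3(1)] lp_add(2)[OF 1(1) 2(1)] by linarith
  with 1 2 3 show "nrm (op_T a b c x) \<le> (A + B + C) * nrm x" by (simp add: algebra_simps)
qed

lemma op_T_bop:
  assumes "bounded (range a)" "bounded (range b)" "bounded (range c)"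
  shows "bop (op_T a b c)"
proof -
  obtain A B C where "\<And>n. norm (a n) \<le> A" "\<And>n. norm (b n) \<le> B" "\<And>n. norm (c n) \<le> C"
    using assms unfolding bounded_iff by (metis rangeI)
  note bound = op_T_bound[OF this]
  show ?thesis by (rule bopI[OF _ op_T_add op_T_scale bound(2)]) (rule bound(1))
qed

lemma op_T_row_finite: "row_finite (op_T a b c)"
  unfolding row_finite_def
proof
  fix n :: nat
  consider "n = 0" | "n \<noteq> 0" "n \<le> 2" | "2 < n" by linarith
  then show "\<exists>S u. finite S \<and> (\<forall>x\<in>lp p. op_T a b c x n = (\<Sum>k\<in>S. u k * x k))"
  proof cases
    case 1
    then show ?thesis by (intro exI[of _ "{}"]) (simp add: op_T_def)
  next
    case 2
    then show ?thesis
      by (intro exI[of _ "{n, n + 2}"] exI[of _ "\<lambda>k. if k = n then a n else b n"]) (simp add: op_T_def)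
  next
    case 3
    then have "n - 2 \<noteq> n" "n - 2 \<noteq> n + 2" by auto
    with 3 show ?thesis
      by (intro exI[of _ "{n - 2, n, n + 2}"] exI[of _ "\<lambda>k. if k = n - 2 then c (n - 2) else if k = n then a n else b n"])
        (simp add: op_T_def)
  qed
qed

text \<open>The equation in row n - 2 can be solved for x n because b (n - 2) is nonzero. For n = 3
  the preceding entry is read at the truncated index 0, where x vanishes too.\<close>

lemma op_T_kernel:
  assumes b: "\<And>n. n \<ge> 1 \<Longrightarrow> b n \<noteq> 0" and eq: "\<And>n. op_T a b c x n = z * x n"
    and low: "\<And>n. n < 3 \<Longrightarrow> x n = 0"
  shows "x = (\<lambda>n. 0)"
proof
  fix n show "x n = 0"
  proof (induction n rule: less_induct)
    case (less n)
    show ?case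
    proof (cases "n < 3")
      case False
      then have n: "n - 2 + 2 = n" "n - 2 \<ge> 1" by auto
      have "x (n - 2) = 0" "x (n - 2 - 2) = 0" by (rule less.IH; use False in simp)+
      with eq[of "n - 2"] n have "b (n - 2) * x n = 0" by (auto simp: op_T_def split: if_splits)
      with b[OF n(2)] show ?thesis by simp
    qed (rule low)
  qed
qed

lemma op_T_unit_seq_in_lp: "op_T a b c (unit_seq j) \<in> lp p"
  by (rule lp_finite_support[of "{1..j + 2}"]) (auto simp: op_T_def unit_seq_def)

text \<open>Row n < N looks at most at entry n + 2, and c (n - 2) only multiplies entries below N,
  so the indices below N + 3 contain all columns that occur.\<close>

lemma op_T_truncated:
  assumes "\<And>n. N \<le> n \<Longrightarrow> a n = 0" "\<And>n. N \<le> n \<Longrightarrow> b n = 0" "\<And>n. N \<le> n \<Longrightarrow> c n = 0"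
  shows "op_T a b c x n = (\<Sum>j<N + 3. x j * op_T a b c (unit_seq j) n)"
proof -
  have pick: "(\<Sum>j<N + 3. x j * (g * (if k = j then 1 else 0))) = g * x k" if "g \<noteq> 0 \<Longrightarrow> k < N + 3" for g k
  proof -
    have "(\<Sum>j<N + 3. x j * (g * (if k = j then 1 else 0))) = (\<Sum>j<N + 3. if k = j then g * x j else 0)"
      by (intro sum.cong) auto
    with that show ?thesis by auto
  qed
  have 1: "a n \<noteq> 0 \<Longrightarrow> n < N + 3" "b n \<noteq> 0 \<Longrightarrow> n + 2 < N + 3" "c (n - 2) \<noteq> 0 \<Longrightarrow> n - 2 < N + 3"
    using assms(1)[of n] assms(2)[of n] assms(3)[of "n - 2"] by linarith+
  note picks = pick[of "a n" n, OF 1(1)] pick[of "b n" "n + 2", OF 1(2)] pick[of "c (n - 2)" "n - 2", OF 1(3)]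
  show ?thesis
  proof (cases "n = 0")
    case False
    have "(\<Sum>j<N + 3. x j * op_T a b c (unit_seq j) n) =
       (\<Sum>j<N + 3. (if n \<le> 2 then 0 else x j * (c (n - 2) * (if n - 2 = j then 1 else 0)))
          + x j * (a n * (if n = j then 1 else 0)) + x j * (b n * (if n + 2 = j then 1 else 0)))"
      using False by (intro sum.cong) (auto simp: op_T_def unit_seq_def distrib_left)
    also have "\<dots> = (if n \<le> 2 then 0 else c (n - 2) * x (n - 2)) + a n * x n + b n * x (n + 2)"
      by (cases "n \<le> 2") (simp_all only: sum.distrib if_True if_False picks sum.neutral_const simp_thms)
    finally show ?thesis using False by (simp add: op_T_def)
  qed (simp add: op_T_def)
qed

lemma op_T_compactly_near:
  assumes bdd: "bounded (range a0)" "bounded (range b0)" "bounded (range c0)"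
      "bounded (range a)" "bounded (range b)" "bounded (range c)"
    and lim: "(\<lambda>n. a n - a0 n) \<longlonglongrightarrow> 0" "(\<lambda>n. b n - b0 n) \<longlonglongrightarrow> 0" "(\<lambda>n. c n - c0 n) \<longlonglongrightarrow> 0"
  shows "compactly_near (op_T a0 b0 c0) (op_T a b c)"
  unfolding compactly_near_def
proof (intro allI impI)
  fix e :: real assume e: "0 < e"
  have "\<exists>N. \<forall>n\<ge>N. norm (a n - a0 n) \<le> e / 3 \<and> norm (b n - b0 n) \<le> e / 3 \<and> norm (c n - c0 n) \<le> e / 3"
  proof -
    obtain N1 N2 N3 where "\<forall>n\<ge>N1. norm (a n - a0 n) < e / 3" "\<forall>n\<ge>N2. norm (b n - b0 n) < e / 3"
       "\<forall>n\<ge>N3. norm (c n - c0 n) < e / 3"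
      using lim[THEN LIMSEQ_D, of "e / 3"] e by (metis diff_zero divide_pos_pos zero_less_numeral)
    then show ?thesis by (intro exI[of _ "max N1 (max N2 N3)"]) (auto intro: less_imp_le)
  qed
  then obtain N where N: "\<And>n. N \<le> n \<Longrightarrow> norm (a n - a0 n) \<le> e / 3"
    "\<And>n. N \<le> n \<Longrightarrow> norm (b n - b0 n) \<le> e / 3" "\<And>n. N \<le> n \<Longrightarrow> norm (c n - c0 n) \<le> e / 3" by blast
  \<comment> \<open>The approximating operator has the coefficients of T0 before N and those of T
    from N on. It differs from T0 only in the small tail, and T differs from it only in the finite
    head \<open>low\<close>. Each of the three diagonals gets e / 3.\<close>
  define cut where "cut u v n = (if n < N then u n else v n)" for u v :: seq and n
  define low where "low u v n = (if n < N then v n - u n else 0)" for u v :: seq and n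
  have cut_bdd: "bounded (range (cut u v))" if "bounded (range u)" "bounded (range v)" for u v
    by (rule bounded_subset[OF bounded_Un[THEN iffD2, OF conjI[OF that]]]) (auto simp: cut_def)
  let ?A = "op_T (cut a0 a) (cut b0 b) (cut c0 c)"
  let ?f = "\<lambda>j. op_T (low a0 a) (low b0 b) (low c0 c) (unit_seq j)"
  have "bop ?A" by (intro op_T_bop cut_bdd bdd)
  moreover have "op_close e ?A (op_T a0 b0 c0)"
    unfolding op_close_def
  proof
    fix x assume x: "x \<in> lp p"
    have "nrm (op_T (\<lambda>n. cut a0 a n - a0 n) (\<lambda>n. cut b0 b n - b0 n) (\<lambda>n. cut c0 c n - c0 n) x)
        \<le> (e / 3 + e / 3 + e / 3) * nrm x"
      by (rule op_T_bound(2)[OF _ _ _ x]) (use N e in \<open>auto simp: cut_def\<close>)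
    then show "nrm (\<lambda>n. ?A x n - op_T a0 b0 c0 x n) \<le> e * nrm x"
      unfolding op_T_diff_coeffs by simp
  qed
  moreover have "finite_rank_correction (op_T a b c) ?A (N + 3) ?f"
    unfolding finite_rank_correction_def
  proof (intro conjI allI impI ballI op_T_unit_seq_in_lp ext)
    fix x n
    have "op_T a b c x n - ?A x n = op_T (low a0 a) (low b0 b) (low c0 c) x n"
      unfolding op_T_diff_coeffs by (rule arg_cong[of _ _ "\<lambda>g. g x n"], intro arg_cong3[of _ _ _ _ _ _ op_T])
        (auto simp: cut_def low_def)
    also have "\<dots> = (\<Sum>j<N + 3. x j * ?f j n)"
      by (rule op_T_truncated) (simp_all add: low_def)
    finally show "op_T a b c x n = ?A x n + (\<Sum>j<N + 3. x j * ?f j n)"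
      unfolding diff_eq_eq by (simp only: add.commute)
  qed
  ultimately show "\<exists>A M f. bop A \<and> op_close e A (op_T a0 b0 c0) \<and> finite_rank_correction (op_T a b c) A M f"
    by blast
qed

end

section \<open>Joukowski parametrization of the bands and the connected complement\<close>

definition band :: "real \<Rightarrow> real \<Rightarrow> complex set" where
  "band r s = complex_of_real ` {r - 2 * s..r + 2 * s}"

text \<open>On the unit circle \<omega> + 1 / \<omega> is twice the cosine of the argument and so
  runs through [-2, 2].\<close>

lemma band_parametrization:
  assumes "0 < s" "z \<in> band r s"
  obtains \<omega> where "norm \<omega> = 1" "z = of_real r + of_real s * (\<omega> + 1 / \<omega>)"
proof -
  from assms obtain t where t: "z = of_real t" "r - 2 * s \<le> t" "t \<le> r + 2 * s" by (auto simp: band_def)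
  define \<theta> where "\<theta> = arccos ((t - r) / (2 * s))"
  have cos: "cos \<theta> = (t - r) / (2 * s)"
    unfolding \<theta>_def using t assms(1) by (intro cos_arccos) (auto simp: field_simps)
  have "cis \<theta> + 1 / cis \<theta> = of_real (2 * cos \<theta>)"
    by (simp add: divide_inverse cis_inverse) (simp add: complex_eq_iff)
  then have "of_real r + of_real s * (cis \<theta> + 1 / cis \<theta>) = complex_of_real (r + s * (2 * cos \<theta>))"
    by simp
  also have "r + s * (2 * cos \<theta>) = t" using assms(1) by (simp add: cos field_simps)
  finally show thesis using that[of "cis \<theta>"] t(1) by simp
qed

text \<open>The two roots of w^2 - \<zeta> w + 1 = 0 are inverse to each other. Off the band neither
  is unimodular, so one of them lies inside the unit disc.\<close>

lemma off_band_parametrization: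
  assumes s: "0 < s" and z: "z \<notin> band r s"
  obtains w where "w \<noteq> 0" "norm w < 1" "z - of_real r = of_real s * (w + 1 / w)"
proof -
  define \<zeta> where "\<zeta> = (z - of_real r) / of_real s"
  define w where "w = (\<zeta> + csqrt (\<zeta>\<^sup>2 - 4)) / 2"
  have "2 * w = \<zeta> + csqrt (\<zeta>\<^sup>2 - 4)" by (simp add: w_def)
  then have "(2 * w - \<zeta>)\<^sup>2 = \<zeta>\<^sup>2 - 4" by simp
  then have "4 * (w * (\<zeta> - w)) = 4 * 1" by (simp add: power2_eq_square algebra_simps)
  then have quad: "w * (\<zeta> - w) = 1" by simp
  then have w0: "w \<noteq> 0" by auto
  from quad have "\<zeta> - w = 1 / w" using w0 by (metis nonzero_mult_div_cancel_left)
  then have \<zeta>: "\<zeta> = w + 1 / w" by (simp only: diff_eq_eq add.commute)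
  have z_eq: "z - of_real r = of_real s * \<zeta>" using s by (simp add: \<zeta>_def)
  \<comment> \<open>On the unit circle 1 / w is the conjugate of w, which would make \<zeta> = 2 Re
    w real of modulus at most 2.\<close>
  have n1: "norm w \<noteq> 1"
  proof
    assume "norm w = 1"
    then have "w * cnj w = 1" using complex_norm_square[of w] by simp
    then have "1 / w = cnj w" using w0 by (metis nonzero_mult_div_cancel_left)
    then have "\<zeta> = of_real (2 * Re w)" using \<zeta> by (simp only: complex_add_cnj)
    then have "z - of_real r = of_real s * of_real (2 * Re w)" using z_eq by (simp only:)
    then have zeq: "z = of_real (r + s * (2 * Re w))"
      by (simp only: diff_eq_eq of_real_add of_real_mult add.commute)
    have "\<bar>Re w\<bar> \<le> 1" using abs_Re_le_cmod[of w] \<open>norm w = 1\<close> by simp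
    then have "\<bar>s * (2 * Re w)\<bar> \<le> 2 * s" using s by (simp add: abs_mult)
    then have "r + s * (2 * Re w) \<in> {r - 2 * s..r + 2 * s}" by auto
    then have "z \<in> band r s" unfolding band_def zeq by (rule imageI)
    with z show False by simp
  qed
  show thesis
  proof (cases "norm w < 1")
    case True
    show ?thesis by (rule that[OF w0 True]) (use z_eq \<zeta> in \<open>simp only:\<close>)
  next
    case False
    then have n2: "norm (1 / w) < 1" using n1 by (simp add: norm_divide divide_less_eq)
    show ?thesis
    proof (rule that[OF _ n2])
      show "1 / w \<noteq> 0" using w0 by simp
      show "z - of_real r = of_real s * (1 / w + 1 / (1 / w))"
        unfolding z_eq \<zeta> by (simp add: add.commute)
    qed
  qed
qed

text \<open>The open half-planes are joined by a disc around a real point to the right of E. The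
  other real points are limits of the upper half-plane, and a set between a connected set and its
  closure is connected.\<close>

lemma connected_complement_bounded_real:
  fixes E :: "complex set"
  assumes real: "E \<subseteq> \<real>" and bdd: "bounded E"
  shows "connected (- E)"
proof -
  obtain K where K: "\<And>z. z \<in> E \<Longrightarrow> norm z < K" using bdd by (meson bounded_pos_less)
  let ?U = "{z. 0 < Im z}" and ?L = "{z. Im z < 0}" and ?B = "ball (of_real (\<bar>K\<bar> + 1)) 1 :: complex set"
  let ?S = "?U \<union> ?B \<union> ?L"
  have "connected ?S"
  proof (intro connected_Un)
    show "connected ?U" by (intro convex_connected convex_halfspace_Im_gt)
    show "connected ?L" by (intro convex_connected convex_halfspace_Im_lt)
    show "connected ?B" by (rule connected_ball)
    have "of_real (\<bar>K\<bar> + 1) + \<i> / 2 \<in> ?U \<inter> ?B" by (simp add: dist_norm norm_divide)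
    then show "?U \<inter> ?B \<noteq> {}" by blast
    have "of_real (\<bar>K\<bar> + 1) - \<i> / 2 \<in> (?U \<union> ?B) \<inter> ?L" by (simp add: dist_norm norm_divide)
    then show "(?U \<union> ?B) \<inter> ?L \<noteq> {}" by blast
  qed
  moreover have "?S \<subseteq> - E"
  proof
    fix z assume z: "z \<in> ?S"
    show "z \<in> - E"
    proof
      assume zE: "z \<in> E"
      with real have "Im z = 0" by (auto simp: complex_is_Real_iff)
      with z have "dist (of_real (\<bar>K\<bar> + 1)) z < 1" by simp
      moreover have "norm (complex_of_real (\<bar>K\<bar> + 1)) = \<bar>K\<bar> + 1"
        unfolding norm_of_real by simp
      ultimately have "\<bar>K\<bar> < norm z"
        using norm_triangle_ineq2[of "complex_of_real (\<bar>K\<bar> + 1)" z] by (simp add: dist_norm)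
      with K[OF zE] show False by simp
    qed
  qed
  moreover have "- E \<subseteq> closure ?S"
  proof
    fix z assume "z \<in> - E"
    show "z \<in> closure ?S"
      unfolding closure_approachable
    proof (intro allI impI)
      fix e :: real assume e: "0 < e"
      show "\<exists>y\<in>?S. dist y z < e"
      proof (cases "Im z < 0")
        case True
        then show ?thesis using e by (intro bexI[of _ z]) simp_all
      next
        case False
        then have "z + \<i> * of_real (e / 2) \<in> ?S" using e by simp
        moreover have "dist (z + \<i> * of_real (e / 2)) z < e" using e by (simp add: dist_norm norm_mult)
        ultimately show ?thesis by blast
      qed
    qed
  qed
  ultimately show ?thesis by (rule connected_intermediate_closure)
qed

section \<open>The spectrum of the free operator\<close>

context lp_exponent
begin

lemma bounded_parity: "bounded (range (\<lambda>n::nat. if odd n then u else v :: complex))"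
  by (rule finite_imp_bounded, rule finite_subset[of _ "{u, v}"]) auto

text \<open>z - T0 = D (I - L) (I - S) with L and S the backward and forward shifts by two, weighted
  by w. The order of the factors matters: L S is multiplication by w^2 in every row n > 0, whereas S
  L would lose this term in the rows 1 and 2.\<close>

lemma free_op_resolvent:
  assumes s: "0 < s1" "0 < s2" and z: "z \<notin> band r1 s1" "z \<notin> band r2 s2"
  shows "z \<notin> spectrum p (op_T0 r1 s1 r2 s2)"
proof -
  obtain w1 where w1: "w1 \<noteq> 0" "norm w1 < 1" "z - of_real r1 = of_real s1 * (w1 + 1 / w1)"
    using off_band_parametrization[OF s(1) z(1)] by blast
  obtain w2 where w2: "w2 \<noteq> 0" "norm w2 < 1" "z - of_real r2 = of_real s2 * (w2 + 1 / w2)"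
    using off_band_parametrization[OF s(2) z(2)] by blast
  define w where "w n = (if odd n then w1 else w2)" for n :: nat
  define s where "s = parity_seq s1 s2"
  define r where "r = parity_seq r1 r2"
  \<comment> \<open>Comparing coefficients demands d w = s off the diagonal and d (1 + w^2) = z - r
    on it. The second is the equation chosen for w.\<close>
  define d where "d n = s n / w n" for n
  have w0: "w n \<noteq> 0" and s0: "s n \<noteq> 0" and zr: "z - r n = s n * (w n + 1 / w n)" for n
    using w1 w2 s by (auto simp: w_def s_def r_def parity_seq_def)
  have shift: "w (n - 2) = w n" "s (n - 2) = s n" if "\<not> n \<le> 2" for n
    using that by (auto simp: w_def s_def parity_seq_def)
  define q where "q = max (norm w1) (norm w2)"
  have q: "0 \<le> q" "q < 1" "norm (w n) \<le> q" for n
    using w1 w2 by (auto simp: q_def w_def le_max_iff_disj)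
  let ?o = "\<lambda>n::nat. 0 :: complex"
  define L where "L = op_T ?o w ?o"
  define S where "S = op_T ?o ?o w"
  define D where "D = op_T d ?o ?o"
  define D' where "D' = op_T (\<lambda>n. 1 / d n) ?o ?o"
  have w_bdd: "bounded (range w)" using bounded_parity[of w1 w2] by (simp add: w_def[abs_def])
  have d_eq: "d = (\<lambda>n. if odd n then of_real s1 / w1 else of_real s2 / w2)"
    by (auto simp: d_def s_def w_def parity_seq_def fun_eq_iff)
  have d_inv_eq: "(\<lambda>n. 1 / d n) = (\<lambda>n. if odd n then 1 / (of_real s1 / w1) else 1 / (of_real s2 / w2))"
    by (auto simp: d_eq fun_eq_iff)
  have o_bdd: "bounded (range ?o)" by simp
  have d_bdd: "bounded (range d)" "bounded (range (\<lambda>n. 1 / d n))"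
    unfolding d_inv_eq unfolding d_eq by (rule bounded_parity)+
  have bops: "bop L" "bop S" "bop D" "bop D'"
    unfolding L_def S_def D_def D'_def
    by (rule op_T_bop[OF o_bdd w_bdd o_bdd] op_T_bop[OF o_bdd o_bdd w_bdd]
        op_T_bop[OF d_bdd(1) o_bdd o_bdd] op_T_bop[OF d_bdd(2) o_bdd o_bdd])+
  have L_nrm: "nrm (L x) \<le> q * nrm x" if "x \<in> lp p" for x
    unfolding L_def using op_T_bound(2)[of ?o 0 w q ?o 0 x] q that by simp
  have S_nrm: "nrm (S x) \<le> q * nrm x" if "x \<in> lp p" for x
    unfolding S_def using op_T_bound(2)[of ?o 0 ?o 0 w q x] q that by simp
  obtain B1 where B1: "inverse_pair (\<lambda>x n. x n - L x n) B1"
    using neumann_series[OF bops(1) q(1,2) L_nrm] by blast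
  obtain B2 where B2: "inverse_pair (\<lambda>x n. x n - S x n) B2"
    using neumann_series[OF bops(2) q(1,2) S_nrm] by blast
  have d0: "d n \<noteq> 0" for n using s0 w0 by (simp add: d_def)
  have D_apply: "D x n = (if n = 0 then 0 else d n * x n)" "D' x n = (if n = 0 then 0 else 1 / d n * x n)" for x n
    by (simp_all add: D_def D'_def op_T_def)
  have D_inv: "inverse_pair D D'"
    unfolding inverse_pair_def
  proof (intro conjI ballI bops ext)
    fix x n assume "x \<in> lp p"
    then have "x 0 = 0" by (rule lp_0)
    then show "D' (D x) n = x n" "D (D' x) n = x n" using d0[of n] by (simp_all add: D_apply)
  qed
  define F where "F = (\<lambda>x n. x n - L x n)"
  define G where "G = (\<lambda>x n. x n - S x n)"
  have FG: "bop F" "bop G" unfolding F_def G_def by (intro bop_minus bop_id bops)+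
  have "inverse_pair (\<lambda>x. F (G x)) (\<lambda>x. B2 (B1 x))"
    by (rule inverse_pair_comp[OF FG]) (use B1 B2 in \<open>simp_all add: F_def G_def\<close>)
  then have "inverse_pair (shifted z (op_T r s s)) (\<lambda>x. B2 (B1 (D' x)))"
  proof (rule inverse_pair_comp[OF bops(3) bop_comp[OF FG] D_inv])
    fix x assume "x \<in> lp p"
    then have x0: "x 0 = 0" by (rule lp_0)
    show "shifted z (op_T r s s) x = D (F (G x))"
    proof
      fix n
      define y where "y = (if n \<le> 2 then 0 else x (n - 2))"
      show "shifted z (op_T r s s) x n = D (F (G x)) n"
      proof (cases "n = 0")
        case False
        have Gx: "G x n = x n - w n * y" "G x (n + 2) = x (n + 2) - w n * x n"
          using False shift(1)[of n] by (auto simp: G_def S_def op_T_def y_def)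
        have "D (F (G x)) n = d n * (x n - w n * y - w n * (x (n + 2) - w n * x n))"
          using False Gx by (simp add: D_apply F_def L_def op_T_def)
        also have "\<dots> = (z - r n) * x n - s n * y - s n * x (n + 2)"
          unfolding zr d_def using w0[of n] by (simp add: field_simps)
        also have "\<dots> = shifted z (op_T r s s) x n"
          using False shift(2)[of n] by (simp add: shifted_def op_T_def y_def algebra_simps)
        finally show ?thesis by simp
      qed (simp add: shifted_def op_T_def D_apply x0)
    qed
  qed
  then show ?thesis by (auto simp: op_T0_eq r_def s_def spectrum_iff)
qed

text \<open>The plane wave lives on one parity class, selected by the parity of \<pi>, where T is
  close to the free operator with constants r and s. Cutting it to L entries causes errors at its
  ends only, bounded independently of L, while its norm grows with L; no bounded inverse tolerates
  this.\<close>

lemma band_in_spectrum: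
  assumes T: "bop (op_T a b c)" and s: "0 < s" and z: "z \<in> band r s"
    and near: "\<And>e. 0 < e \<Longrightarrow> \<exists>N. \<forall>n\<ge>N. even (n + \<pi>) \<longrightarrow>
        norm (a n - of_real r) \<le> e \<and> norm (b n - of_real s) \<le> e \<and> norm (c n - of_real s) \<le> e"
  shows "z \<in> spectrum p (op_T a b c)"
proof (rule ccontr)
  assume nz: "z \<notin> spectrum p (op_T a b c)"
  let ?T = "op_T a b c" and ?F = "op_T (\<lambda>_. of_real r) (\<lambda>_. of_real s) (\<lambda>_. of_real s)"
  obtain \<omega> where \<omega>: "norm \<omega> = 1" "z = of_real r + of_real s * (\<omega> + 1 / \<omega>)"
    using band_parametrization[OF s z] by blast
  have \<omega>0: "\<omega> \<noteq> 0" using \<omega>(1) by auto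
  obtain K where K: "0 \<le> K" "\<And>x. x \<in> lp p \<Longrightarrow> nrm (resolvent p ?T z x) \<le> K * nrm x"
    using bop_bound[OF resolvent_bop[OF nz]] by blast
  \<comment> \<open>Three diagonals, each within e of its limit, give an error of 3 e times the norm
    of x. Multiplied by K this is at most half the norm of x and can be absorbed.\<close>
  define e where "e = 1 / (6 * (K + 1))"
  have e: "0 < e" "K * (3 * e) \<le> 1 / 2" using K(1) by (auto simp: e_def field_simps)
  obtain N where N: "\<And>n. N \<le> n \<Longrightarrow> even (n + \<pi>) \<Longrightarrow>
      norm (a n - of_real r) \<le> e \<and> norm (b n - of_real s) \<le> e \<and> norm (c n - of_real s) \<le> e"
    using near[OF e(1)] by blast
  define n0 where "n0 = 2 * (N + 3) + \<pi>"
  have n0: "N + 2 \<le> n0" "3 \<le> n0" "even (n0 + \<pi>)" by (auto simp: n0_def)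
  define C where "C = norm z + \<bar>r\<bar> + 2 * s"
  define H where "H = 8 * K * C + 1"
  have CH: "0 \<le> C" "0 < H" using K(1) s by (auto simp: C_def H_def intro!: add_nonneg_pos mult_nonneg_nonneg)
  \<comment> \<open>The wave has L entries of modulus 1, so its norm to the power p is at least L.
    This pushes the norm above H, beyond the bound 8 K C derived at the end.\<close>
  obtain L :: nat where L: "H powr p < real L" using reals_Archimedean2 by blast
  define x where "x n = (if n0 \<le> n \<and> n < n0 + 2 * L \<and> even (n - n0) then \<omega> ^ ((n - n0) div 2) else 0)" for n
  have x_at: "x (n0 + 2 * k) = (if k < L then \<omega> ^ k else 0)" for k by (simp add: x_def)
  have x_off: "x n = 0" if "\<And>k. n \<noteq> n0 + 2 * k" for n
  proof (rule ccontr)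
    assume "x n \<noteq> 0"
    then have "n0 \<le> n" "even (n - n0)" by (auto simp: x_def split: if_splits)
    then have "n = n0 + 2 * ((n - n0) div 2)" by simp
    with that show False by blast
  qed
  have x_le: "norm (x n) \<le> 1" for n using \<omega>(1) by (simp add: x_def norm_power)
  have x_low: "x n = 0" if "n < n0" for n using that by (simp add: x_def)
  have x: "x \<in> lp p"
    by (rule lp_finite_support[of "{n0..<n0 + 2 * L}"]) (use n0 in \<open>auto simp: x_def\<close>)
  have "real L = (\<Sum>n\<in>(\<lambda>k. n0 + 2 * k) ` {..<L}. norm (x n) powr p)"
    by (subst sum.reindex) (auto simp: inj_on_def x_at norm_power \<omega>(1))
  also have "\<dots> \<le> nrm x powr p" by (rule sum_powr_le_nrm[OF x]) simp
  finally have "H powr p < nrm x powr p" using L by simp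
  then have big: "H < nrm x"
    using powr_mono2[OF p_pos(2) nrm_nonneg, of x H] by (meson not_le)
  \<comment> \<open>Deviations of the coefficients, set to 0 outside the controlled indices.
    Replacing them changes nothing at x, whose support lies within the controlled indices, and makes
    the bound e uniform.\<close>
  define \<alpha> where "\<alpha> n = (if N \<le> n \<and> even (n + \<pi>) then a n - of_real r else 0)" for n
  define \<beta> where "\<beta> n = (if N \<le> n \<and> even (n + \<pi>) then b n - of_real s else 0)" for n
  define \<gamma> where "\<gamma> n = (if N \<le> n \<and> even (n + \<pi>) then c n - of_real s else 0)" for n
  have x_nz: "N + 2 \<le> n \<and> even (n + \<pi>)" if "x n \<noteq> 0" for n
    using that n0 by (auto simp: x_def split: if_splits)
  have diff: "?T x n - ?F x n = op_T \<alpha> \<beta> \<gamma> x n" for n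
  proof -
    have 1: "(a n - of_real r) * x n = \<alpha> n * x n" using x_nz[of "n"]
      by (cases "x (n) = 0") (auto simp: \<alpha>_def)
    have 2: "(b n - of_real s) * x (n + 2) = \<beta> n * x (n + 2)" using x_nz[of "n + 2"]
      by (cases "x (n + 2) = 0") (auto simp: \<beta>_def)
    have 3: "(c (n - 2) - of_real s) * x (n - 2) = \<gamma> (n - 2) * x (n - 2)"
      using x_nz[of "n - 2"]
      by (cases "x (n - 2) = 0") (auto simp: \<gamma>_def)
    show ?thesis unfolding op_T_diff_coeffs unfolding op_T_def 1 2 3 ..
  qed
  have small: "op_T \<alpha> \<beta> \<gamma> x \<in> lp p" "nrm (op_T \<alpha> \<beta> \<gamma> x) \<le> (e + e + e) * nrm x"
    by (rule op_T_bound[OF _ _ _ x]; use N e in \<open>auto simp: \<alpha>_def \<beta>_def \<gamma>_def\<close>)+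
  define y where "y = shifted z ?F x"
  \<comment> \<open>The index before the wave, its first and last index, and the index after it;
    elsewhere the free recurrence holds exactly.\<close>
  let ?E = "{n0 - 2, n0, n0 + 2 * (L - 1), n0 + 2 * L}"
  have y_eq: "y n = z * x n - ((if n \<le> 2 then 0 else of_real s * x (n - 2)) + of_real r * x n + of_real s * x (n + 2))"
    if "n \<noteq> 0" for n using that by (simp add: y_def shifted_def op_T_def)
  have y0: "y 0 = 0" using x_low[of 0] n0 by (simp add: y_def shifted_def op_T_def)
  have y_off: "y n = 0" if n: "n \<notin> ?E" for n
  proof (cases "\<exists>k. n = n0 + 2 * k")
    case True
    then obtain k where k: "n = n0 + 2 * k" by blast
    have "k \<noteq> 0" "k \<noteq> L - 1" "k \<noteq> L" using n k by auto
    then obtain i where i: "k = Suc i" by (cases k) auto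
    have "n - 2 = n0 + 2 * i" "n + 2 = n0 + 2 * Suc (Suc i)" using k i by auto
    then have vals: "x n = (if Suc i < L then \<omega> ^ Suc i else 0)" "x (n - 2) = (if i < L then \<omega> ^ i else 0)"
      "x (n + 2) = (if Suc (Suc i) < L then \<omega> ^ Suc (Suc i) else 0)"
      using x_at[of i] x_at[of "Suc i"] x_at[of "Suc (Suc i)"] k i by simp_all
    have n': "n \<noteq> 0" "\<not> n \<le> 2" using n0 k i by auto
    show ?thesis
    proof (cases "Suc (Suc i) < L")
      case True
      have "z * \<omega> ^ Suc i = of_real r * \<omega> ^ Suc i + of_real s * (\<omega> ^ Suc (Suc i) + \<omega> ^ i)"
        unfolding \<omega>(2) using \<omega>0 by (simp add: field_simps)
      with True show ?thesis unfolding y_eq[OF n'(1)] using n'(2) vals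
        by (simp add: distrib_left del: power_Suc)
    next
      case False
      then have "L \<le> i" using \<open>k \<noteq> L - 1\<close> \<open>k \<noteq> L\<close> i by auto
      then show ?thesis unfolding y_eq[OF n'(1)] using vals by simp
    qed
  next
    case False
    have 1: "x n = 0" by (rule x_off) (use False in blast)
    have 2: "x (n + 2) = 0"
    proof (rule x_off)
      fix k show "n + 2 \<noteq> n0 + 2 * k"
      proof
        assume eq: "n + 2 = n0 + 2 * k"
        with n have "k \<noteq> 0" by (cases k) auto
        then obtain i where "k = Suc i" by (cases k) auto
        with eq False show False by auto
      qed
    qed
    have 3: "x (n - 2) = 0" if "\<not> n \<le> 2"
    proof (rule x_off)
      fix k show "n - 2 \<noteq> n0 + 2 * k"
      proof
        assume "n - 2 = n0 + 2 * k"
        with that have "n = n0 + 2 * Suc k" by auto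
        with False show False by blast
      qed
    qed
    show ?thesis
    proof (cases "n = 0")
      case False
      then show ?thesis unfolding y_eq[OF False] using 1 2 3 by simp
    qed (simp add: y0)
  qed
  have y_le: "norm (y n) \<le> C" for n
  proof (cases "n = 0")
    case False
    have "norm (y n) \<le> norm (z * x n) + (norm (if n \<le> 2 then 0 else of_real s * x (n - 2))
        + norm (of_real r * x n) + norm (of_real s * x (n + 2)))"
      unfolding y_eq[OF False]
      by (intro order_trans[OF norm_triangle_ineq4] add_left_mono order_trans[OF norm_triangle_ineq] add_mono order_refl)
    also have "\<dots> \<le> norm z + (s + \<bar>r\<bar> + s)"
      using x_le s mult_left_mono[OF x_le[of n], of "norm z"] mult_left_mono[OF x_le[of n], of "\<bar>r\<bar>"]
        mult_left_mono[OF x_le[of "n - 2"], of s] mult_left_mono[OF x_le[of "n + 2"], of s]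
      by (intro add_mono) (auto simp: norm_mult)
    finally show ?thesis by (simp add: C_def)
  qed (simp add: y0 CH)
  have E0: "finite ?E" "0 \<notin> ?E" using n0 by auto
  have y: "y \<in> lp p" by (rule lp_finite_support[OF E0 y_off])
  have "nrm y \<le> (\<Sum>n\<in>?E. norm (y n))" by (rule nrm_finite_support[OF E0 y_off])
  also have "\<dots> \<le> real (card ?E) * C" by (rule sum_bounded_above) (rule y_le)
  also have "\<dots> \<le> 4 * C"
  proof -
    have "card ?E \<le> 4" by (simp add: card_insert_if)
    then show ?thesis using CH(1) by (intro mult_right_mono) auto
  qed
  finally have ny: "nrm y \<le> 4 * C" .
  have "shifted z ?T x = (\<lambda>n. y n - op_T \<alpha> \<beta> \<gamma> x n)"
    using diff by (simp add: y_def shifted_def fun_eq_iff diff_eq_eq algebra_simps)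
  then have "nrm (shifted z ?T x) \<le> 4 * C + (3 * e) * nrm x"
    using lp_diff(2)[OF y small(1)] ny small(2) by simp
  then have "K * nrm (shifted z ?T x) \<le> K * (4 * C + (3 * e) * nrm x)"
    by (rule mult_left_mono[OF _ K(1)])
  moreover have "nrm x \<le> K * nrm (shifted z ?T x)"
    using K(2)[OF bop_in_lp[OF bop_shifted[OF T, of z] x]] by (simp add: resolvent_shifted[OF nz x])
  moreover have "K * (3 * e) * nrm x \<le> 1 / 2 * nrm x" by (rule mult_right_mono[OF e(2)]) simp
  ultimately have "nrm x \<le> 8 * K * C" by (simp add: algebra_simps)
  with big show False by (simp add: H_def)
qed

end

section \<open>From the two parity subsequences to the spectra of T and T0\<close>

lemma parity_limit:
  assumes "(\<lambda>n. a (2 * n - 1)) \<longlonglongrightarrow> of_real u" "(\<lambda>n. a (2 * n)) \<longlonglongrightarrow> of_real v"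
  shows "(\<lambda>n. a n - parity_seq u v n) \<longlonglongrightarrow> 0"
proof (rule LIMSEQ_I)
  fix e :: real assume e: "0 < e"
  obtain N1 where N1: "\<And>k. N1 \<le> k \<Longrightarrow> norm (a (2 * k - 1) - of_real u) < e"
    using LIMSEQ_D[OF assms(1) e] by blast
  obtain N2 where N2: "\<And>k. N2 \<le> k \<Longrightarrow> norm (a (2 * k) - of_real v) < e"
    using LIMSEQ_D[OF assms(2) e] by blast
  have "norm (a n - parity_seq u v n - 0) < e" if n: "2 * max N1 N2 \<le> n" for n
  proof (cases "even n")
    case True
    then obtain k where "n = 2 * k" by blast
    then show ?thesis using N2[of k] n by (simp add: parity_seq_def)
  next
    case False
    then obtain k where "n = 2 * k + 1" by (rule oddE)
    \<comment> \<open>The odd number 2 k + 1 is the entry 2 n - 1 of the subsequence for n = k +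
      1.\<close>
    then show ?thesis using N1[of "Suc k"] n by (simp add: parity_seq_def)
  qed
  then show "\<exists>N. \<forall>n\<ge>N. norm (a n - parity_seq u v n - 0) < e" by blast
qed

lemma bounded_if_near_parity_seq:
  assumes "(\<lambda>n. a n - parity_seq u v n) \<longlonglongrightarrow> 0"
  shows "bounded (range a)" "bounded (range (parity_seq u v))"
proof -
  show 1: "bounded (range (parity_seq u v))"
    by (rule finite_imp_bounded, rule finite_subset[of _ "{of_real u, of_real v}"]) (auto simp: parity_seq_def)
  have "bounded (range (\<lambda>n. a n - parity_seq u v n))"
    using assms by (rule convergent_imp_bounded)
  from bounded_plus_comp[OF this 1] show "bounded (range a)" by simp
qed

theorem theorem4p3:
  fixes p r1 r2 s1 s2 :: real
    and a b c :: "nat \<Rightarrow> complex"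
  assumes "1 < p"
    and "0 \<le> r1" and "0 \<le> r2" and "0 < s1" and "0 < s2"
    and "\<And>n. n \<ge> 1 \<Longrightarrow> b n \<noteq> 0"
    and "\<And>n. n \<ge> 1 \<Longrightarrow> c n \<noteq> 0"
    and "(\<lambda>n. a (2 * n - 1)) \<longlonglongrightarrow> of_real r1"
    and "(\<lambda>n. b (2 * n - 1)) \<longlonglongrightarrow> of_real s1"
    and "(\<lambda>n. c (2 * n - 1)) \<longlonglongrightarrow> of_real s1"
    and "(\<lambda>n. a (2 * n)) \<longlonglongrightarrow> of_real r2"
    and "(\<lambda>n. b (2 * n)) \<longlonglongrightarrow> of_real s2"
    and "(\<lambda>n. c (2 * n)) \<longlonglongrightarrow> of_real s2"
  shows "spectrum p (op_T0 r1 s1 r2 s2) \<subseteq> spectrum p (op_T a b c)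
     \<and> (\<forall>z \<in> spectrum p (op_T a b c) - spectrum p (op_T0 r1 s1 r2 s2).
          finite_type_eigenvalue p (op_T a b c) z)
     \<and> countable (spectrum p (op_T a b c) - spectrum p (op_T0 r1 s1 r2 s2))
     \<and> (\<forall>z \<in> spectrum p (op_T a b c) - spectrum p (op_T0 r1 s1 r2 s2).
          \<not> z islimpt (spectrum p (op_T a b c) - spectrum p (op_T0 r1 s1 r2 s2)))"
proof -
  interpret lp_exponent p by unfold_locales (use assms(1) in simp)
  note s = assms(4,5)
  define T where "T = op_T a b c"
  define T0 where "T0 = op_T0 r1 s1 r2 s2"
  define E where "E = band r1 s1 \<union> band r2 s2"
  define r where "r = parity_seq r1 r2"
  define q where "q = parity_seq s1 s2"
  have lim: "(\<lambda>n. a n - r n) \<longlonglongrightarrow> 0" "(\<lambda>n. b n - q n) \<longlonglongrightarrow> 0" "(\<lambda>n. c n - q n) \<longlonglongrightarrow> 0"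
    unfolding r_def q_def by (intro parity_limit assms)+
  note bdd = bounded_if_near_parity_seq[OF lim(1)[unfolded r_def], folded r_def]
    bounded_if_near_parity_seq[OF lim(2)[unfolded q_def], folded q_def]
    bounded_if_near_parity_seq[OF lim(3)[unfolded q_def], folded q_def]
  have T: "bop T" unfolding T_def by (intro op_T_bop bdd)
  have T0_eq: "T0 = op_T r q q" by (simp add: T0_def op_T0_eq r_def q_def)
  have T0: "bop T0" unfolding T0_eq by (intro op_T_bop bdd)
  have near: "compactly_near T0 T"
    unfolding T0_eq T_def by (rule op_T_compactly_near[OF bdd(2,4,4) bdd(1,3,5) lim])
  \<comment> \<open>Stated for arbitrary coefficients with the given limits, because it is applied
    twice: to T for the inclusion of the spectra, and to T0 itself to identify its spectrum with
    E.\<close>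
  have E_sub: "E \<subseteq> spectrum p (op_T a' b' c')"
    if bop': "bop (op_T a' b' c')"
      and lim': "(\<lambda>n. a' n - r n) \<longlonglongrightarrow> 0" "(\<lambda>n. b' n - q n) \<longlonglongrightarrow> 0" "(\<lambda>n. c' n - q n) \<longlonglongrightarrow> 0" for a' b' c'
  proof -
    have ev: "\<exists>N. \<forall>n\<ge>N. norm (a' n - r n) \<le> e \<and> norm (b' n - q n) \<le> e \<and> norm (c' n - q n) \<le> e"
      if e: "0 < e" for e
    proof -
      have "\<forall>\<^sub>F n in sequentially. norm (a' n - r n) < e \<and> norm (b' n - q n) < e \<and> norm (c' n - q n) < e"
        using lim'[THEN tendstoD, OF e] by (simp add: dist_norm eventually_conj_iff)
      then show ?thesis unfolding eventually_sequentially by (meson less_imp_le)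
    qed
    have "band r1 s1 \<subseteq> spectrum p (op_T a' b' c')"
    proof
      fix z assume z: "z \<in> band r1 s1"
      show "z \<in> spectrum p (op_T a' b' c')"
      proof (rule band_in_spectrum[OF bop' s(1) z, of 1])
        fix e :: real assume "0 < e"
        from ev[OF this] obtain N where N: "\<forall>n\<ge>N. norm (a' n - r n) \<le> e \<and> norm (b' n - q n) \<le> e \<and> norm (c' n - q n) \<le> e" ..
        have "r n = of_real r1" "q n = of_real s1" if "even (n + 1)" for n
          using that by (simp_all add: r_def q_def parity_seq_def)
        with N show "\<exists>N. \<forall>n\<ge>N. even (n + 1) \<longrightarrow> norm (a' n - of_real r1) \<le> e \<and>
            norm (b' n - of_real s1) \<le> e \<and> norm (c' n - of_real s1) \<le> e"
          by (intro exI[of _ N]) metis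
      qed
    qed
    moreover have "band r2 s2 \<subseteq> spectrum p (op_T a' b' c')"
    proof
      fix z assume z: "z \<in> band r2 s2"
      show "z \<in> spectrum p (op_T a' b' c')"
      proof (rule band_in_spectrum[OF bop' s(2) z, of 0])
        fix e :: real assume "0 < e"
        from ev[OF this] obtain N where N: "\<forall>n\<ge>N. norm (a' n - r n) \<le> e \<and> norm (b' n - q n) \<le> e \<and> norm (c' n - q n) \<le> e" ..
        have "r n = of_real r2" "q n = of_real s2" if "even (n + 0)" for n
          using that by (simp_all add: r_def q_def parity_seq_def)
        with N show "\<exists>N. \<forall>n\<ge>N. even (n + 0) \<longrightarrow> norm (a' n - of_real r2) \<le> e \<and>
            norm (b' n - of_real s2) \<le> e \<and> norm (c' n - of_real s2) \<le> e"
          by (intro exI[of _ N]) metis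
      qed
    qed
    ultimately show ?thesis by (simp add: E_def)
  qed
  have E_T: "E \<subseteq> spectrum p T" unfolding T_def by (rule E_sub[OF T[unfolded T_def] lim])
  have E_T0: "E \<subseteq> spectrum p T0" unfolding T0_eq by (rule E_sub[OF T0[unfolded T0_eq]]) simp_all
  have "spectrum p T0 \<subseteq> E"
    using free_op_resolvent[OF s] unfolding E_def T0_def by blast
  with E_T0 have spec0: "spectrum p T0 = E" by (rule equalityI[rotated])
  have "connected (- E)"
  proof (rule connected_complement_bounded_real)
    show "E \<subseteq> \<real>" by (auto simp: E_def band_def)
    have "bounded (band u v)" for u v
      unfolding band_def by (intro compact_imp_bounded compact_continuous_image continuous_intros) simp
    then show "bounded E" by (simp add: E_def)
  qed
  then have conn: "connected (- spectrum p T0)" by (simp add: spec0)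
  have isolated: "\<exists>r>0. cball z r \<inter> spectrum p T \<subseteq> {z}" if z: "z \<notin> spectrum p T0" for z
  proof -
    obtain r m where "0 < r" "\<And>w. w \<in> cball z r - {z} \<Longrightarrow> w \<notin> spectrum p T"
      using meromorphic_resolvent[OF T0 T near conn z] by metis
    then have "0 < r" "cball z r \<inter> spectrum p T \<subseteq> {z}" by blast+
    then show ?thesis by blast
  qed
  have fin: "finite_type_eigenvalue p T z" if z: "z \<in> spectrum p T" "z \<notin> spectrum p T0" for z
  proof -
    obtain r m where rad: "0 < r" "\<And>w. w \<in> cball z r - {z} \<Longrightarrow> w \<notin> spectrum p T"
      and pole: "\<And>x n. x \<in> lp p \<Longrightarrow> \<exists>h. h holomorphic_on cball z r \<and>
        (\<forall>w\<in>cball z r - {z}. (w - z) ^ m * resolvent p T w x n = h w)"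
      using meromorphic_resolvent[OF T0 T near conn z(2)] by metis
    interpret isolated_circle p T z r
      by unfold_locales (use T op_T_row_finite rad in \<open>auto simp: T_def\<close>)
    show ?thesis
    proof (rule finite_type_eigenvalueI[OF z(1) _ pole])
      have "z \<in> cball z r" using rad(1) by simp
      then show "cball z r \<inter> spectrum p T = {z}" using rad(2) z(1) by blast
      \<comment> \<open>Row n < N involves no entry beyond n + 2 < N + 2.\<close>
      show "y n = 0" if "y = (\<lambda>n. T x n - z * x n)" "\<And>n. n < N + 2 \<Longrightarrow> x n = 0" "n < N" for x y N n
        using that by (simp add: T_def op_T_def)
      show "x = (\<lambda>n. 0)" if "\<And>n. T x n = z * x n" "\<And>n. n < 3 \<Longrightarrow> x n = 0" for x
        using op_T_kernel[OF assms(6) that(1)[unfolded T_def] that(2)] .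
    qed
  qed
  let ?X = "spectrum p T - spectrum p T0"
  \<comment> \<open>Proved at every point off the spectrum of T0, not just at points of the
    difference; this is the form that sparseness in the open complement requires, and countability
    follows from it.\<close>
  have nolim: "\<not> z islimpt ?X" if z: "z \<notin> spectrum p T0" for z
  proof -
    obtain r where r: "0 < r" "cball z r \<inter> spectrum p T \<subseteq> {z}" using isolated[OF z] by blast
    show ?thesis
    proof
      assume "z islimpt ?X"
      then obtain y where "y \<in> ?X" "y \<in> ball z r" "y \<noteq> z"
        using r(1) unfolding islimpt_def by (metis centre_in_ball open_ball)
      then have "y \<in> cball z r \<inter> spectrum p T" using ball_subset_cball by blast
      with r(2) \<open>y \<noteq> z\<close> show False by blast
    qed
  qed
  have "?X sparse_in - spectrum p T0"
    unfolding sparse_in_def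
    using nolim spectrum_closed[OF T0] by (intro ballI exI[of _ "- spectrum p T0"]) (auto simp: open_Compl)
  then have "countable (- spectrum p T0 \<inter> ?X)"
    using spectrum_closed[OF T0] by (intro sparse_imp_countable) (auto simp: open_Compl)
  moreover have "- spectrum p T0 \<inter> ?X = ?X" by blast
  ultimately have "countable ?X" by simp
  with E_T fin nolim show ?thesis
    unfolding T_def[symmetric] T0_def[symmetric] by (simp add: spec0)
qed

end
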